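(* Let $C\subseteq\mathbb{R}^2$ be the interior of a strictly convex body. Let $c\in(0,1)$. Let $P$ be a Borel probability distribution on $\mathbb{R}^2$ such that $P(\operatorname{bd}(x+C))=0$ for all $x\in\mathbb{R}^2$. Let $X$ be a random set of $n$ i.i.d. points, each distributed according to $P$. Let $A_n$ (resp. $E_n$) be the number of $T_C$-$k$-sets (resp. $T_C$-$k$-edges) of $X$ for $k=\lfloor cn\rfloor$. Then $$\mathbb{E}(E_n)\le O(n^{3/2})\qquad\text{and}\qquad \mathbb{E}(A_n)\le O(n^{3/2}),$$ where the constants in the big-$O$ depend only on $c$.
   Context: A convex body is a compact convex set with non-empty interior; a set $K$ is strictly convex if for all $x\ne y$ in $K$ and $\lambda\in(0,1)$, $\lambda x+(1-\lambda)y\in\operatorname{int}K$. For $C$ the interior of a strictly convex body in $\mathbb{R}^2$, $T_C=\{x+C: x\in\mathbb{R}^2\}$ is the family of translations of $C$; its elements are called ranges (they are open sets, so a point on the boundary of a range is not in the range). A $T_C$-$k$-set of a finite set $S\subseteq\mathbb{R}^2$ is a subset $T\subseteq S$ of $k$ points such that for some $Q\in T_C$ we have $S\cap\operatorname{bd}Q=\emptyset$ and $T=S\cap Q$. A set of points is in general position relative to $C$ if no three of its (distinct) points lie on the boundary of a common range in $T_C$. Let $V\subseteq(\mathbb{R}^2)^2$ be the set of ordered pairs $(p,q)$ of distinct points such that $p,q\in\operatorname{bd}Q$ for some $Q\in T_C$. For each $(p,q)\in V$ there are one or two ranges having both $p$ and $q$ on their boundary. Define $\mathcal{C}(p,q)\in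 T_C$ as follows: if there is exactly one such range, $\mathcal{C}(p,q)$ is that range; if there are two such ranges $C_1,C_2$, $\mathcal{C}(p,q)$ is the unique one among them maximizing $\operatorname{area}(C_i\cap \operatorname{aff}(p,q)^+)$, where $\operatorname{aff}(p,q)^+=\{r: -(q-p)_x(r-p)_y+(q-p)_y(r-p)_x>0\}$ (subscripts $x,y$ denote coordinates). For a finite set $S$ in general position relative to $C$, a $T_C$-$k$-edge of $S$ is an ordered pair $(p,q)\in V$ with $p,q\in S$, $p\ne q$, such that $\mathcal{C}(p,q)$ contains exactly $k$ points of $S$. (Under the hypotheses of the claim, $X$ consists of $n$ distinct points in general position relative to $C$ almost surely, so $E_n$ is defined almost surely.) *)

theory Defs
  imports "HOL-Probability.Probability"
begin

definition convex_body :: "'a::euclidean_space set \<Rightarrow> bool" where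
  "convex_body K \<longleftrightarrow> compact K \<and> convex K \<and> interior K \<noteq> {}"

definition strictly_convex :: "'a::euclidean_space set \<Rightarrow> bool" where
  "strictly_convex K \<longleftrightarrow>
     (\<forall>x\<in>K. \<forall>y\<in>K. x \<noteq> y \<longrightarrow> (\<forall>t\<in>{0<..<1}. t *\<^sub>R x + (1 - t) *\<^sub>R y \<in> interior K))"

definition interior_strictly_convex_body :: "'a::euclidean_space set \<Rightarrow> bool" where
  "interior_strictly_convex_body C \<longleftrightarrow>
     (\<exists>K. convex_body K \<and> strictly_convex K \<and> C = interior K)"

definition translates :: "'a::euclidean_space set \<Rightarrow> 'a set set" where
  "translates C = range (\<lambda>x. (+) x ` C)"

definition k_sets :: "(real^2) set \<Rightarrow> nat \<Rightarrow> (real^2) set \<Rightarrow> (real^2) set set" where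
  "k_sets C k S =
     {T. T \<subseteq> S \<and> card T = k \<and> (\<exists>Q\<in>translates C. S \<inter> frontier Q = {} \<and> T = S \<inter> Q)}"

definition ranges_through :: "(real^2) set \<Rightarrow> real^2 \<Rightarrow> real^2 \<Rightarrow> (real^2) set set" where
  "ranges_through C p q = {Q \<in> translates C. p \<in> frontier Q \<and> q \<in> frontier Q}"

definition chord_pairs :: "(real^2) set \<Rightarrow> ((real^2) \<times> (real^2)) set" where
  "chord_pairs C = {(p, q). p \<noteq> q \<and> ranges_through C p q \<noteq> {}}"

definition aff_plus :: "real^2 \<Rightarrow> real^2 \<Rightarrow> (real^2) set" where
  "aff_plus p q = {r. - ((q - p) $ 1) * ((r - p) $ 2) + (q - p) $ 2 * (r - p) $ 1 > 0}"

text \<open>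
  For a pair in \<^const>\<open>chord_pairs\<close> there are one or two ranges through \<open>p\<close> and \<open>q\<close>.
  If there is one, it is trivially the unique area maximizer below; if there are two,
  exactly one of them maximizes the area. On other pairs the value is irrelevant.
\<close>

definition edge_range :: "(real^2) set \<Rightarrow> real^2 \<Rightarrow> real^2 \<Rightarrow> (real^2) set" where
  "edge_range C p q =
     (THE Q. is_arg_max (\<lambda>Q. measure lborel (Q \<inter> aff_plus p q)) (\<lambda>Q. Q \<in> ranges_through C p q) Q)"

text \<open>
  The \<open>k\<close>-edges are meant for sets \<open>S\<close> in general position relative to \<open>C\<close>; the same
  formula is used for all \<open>S\<close>. For the random sets considered here, general position
  holds almost surely, so the extension does not affect expectations.
\<close>

definition k_edges :: "(real^2) set \<Rightarrow> nat \<Rightarrow> (real^2) set \<Rightarrow> ((real^2) \<times> (real^2)) set" where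
  "k_edges C k S =
     {(p, q) \<in> chord_pairs C. p \<in> S \<and> q \<in> S \<and> card (S \<inter> edge_range C p q) = k}"

end

theory Submission
  imports Defs
begin

text \<open>
  Both bounds come from one fact about the binomial distribution. Let \<open>p\<close> and \<open>q\<close> be two of
  the \<open>n\<close> sample points that lie on the boundary of a common range. The ordered pair determines one
  such range \<open>Q\<close>, and, given \<open>p\<close> and \<open>q\<close>, the number of the other \<open>n - 2\<close> points that fall into \<open>Q\<close> is binomially distributed. Whatever
  the success probability is, a binomial distribution gives a value near \<open>c * n\<close> a probability of at
  most a constant times \<open>1 / sqrt n\<close> (lemma \<open>binomial_weight_linear_bound\<close>). Summing over the at most
  \<open>n\<^sup>2\<close> ordered pairs bounds the expected number of \<open>k\<close>-edges by a multiple of \<open>n powr (3/2)\<close> (lemma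
  \<open>expected_k_edges\<close>).

  The sets reduce to edges by a deterministic argument (lemma \<open>card_k_sets_le\<close>). The centres of the
  ranges that cut a set \<open>T\<close> off from \<open>S\<close> form a bounded open region. Move the centre to a topmost
  point of the closure of this region. By strict convexity the range is then either in the unique
  position where some point of \<open>T\<close> is its lowest boundary point, which happens for at most \<open>card S\<close>
  sets, or it has two points \<open>p\<close>, \<open>q\<close> of \<open>S\<close> on its boundary. In general position it has no third
  one, so \<open>T\<close> is determined by the range together with \<open>T \<inter> {p, q}\<close>, and the range
  contains between \<open>k - 2\<close> and \<open>k\<close> points. Through \<open>p\<close> and \<open>q\<close> there are only two translates, namely
  the ranges belonging to \<open>(p, q)\<close> and to \<open>(q, p)\<close>. Hence up to a linear term the number of \<open>k\<close>-sets
  is at most four times the number of \<open>m\<close>-edges with \<open>k - 2 \<le> m \<le> k\<close>. General position holds almost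
  surely because boundaries of translates are null sets.

  The remaining work is measurability. The area maximiser in the definition of the range of an edge
  is characterised by an extremal value of a continuous function on a compact set (lemma
  \<open>edge_range_eq\<close>), which makes its centre a Borel function of \<open>(p, q)\<close>; and a set is cut off by some
  range if and only if it is cut off by one whose centre lies in a fixed countable dense set.
\<close>

section \<open>The cross product in the plane\<close>

text \<open>
  For fixed \<open>v\<close> this measures the signed distance from the line spanned by \<open>v\<close>, up to the factor
  \<open>norm v\<close>. It orders the parallel copies of a chord with direction \<open>v\<close>.
\<close>

definition cross :: "real^2 \<Rightarrow> real^2 \<Rightarrow> real" where
  "cross v a = v $ 1 * a $ 2 - v $ 2 * a $ 1"

lemma cross_add [simp]: "cross v (a + b) = cross v a + cross v b"
  and cross_diff [simp]: "cross v (a - b) = cross v a - cross v b"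
  and cross_scaleR [simp]: "cross v (t *\<^sub>R a) = t * cross v a"
  and cross_self [simp]: "cross v v = 0"
  and cross_minus_left [simp]: "cross (- v) a = - cross v a"
  by (simp_all add: cross_def algebra_simps)

lemma continuous_on_cross [continuous_intros]:
  assumes "continuous_on S f" "continuous_on S g"
  shows "continuous_on S (\<lambda>x. cross (f x) (g x))"
  unfolding cross_def by (intro continuous_intros assms)

lemma mem_translate: "p \<in> (+) x ` S \<longleftrightarrow> p - x \<in> S" for x :: "'a::ab_group_add"
  by (force simp: image_iff algebra_simps)

lemma frontier_translate: "p \<in> frontier ((+) x ` C) \<longleftrightarrow> p - x \<in> frontier C"
  for x :: "'a::euclidean_space"
  by (simp add: frontier_translation mem_translate)

lemma parallel_if_cross_eq_0:
  assumes "v \<noteq> 0" "cross v a = 0"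
  obtains s where "a = s *\<^sub>R v"
proof (cases "v $ 1 = 0")
  case True
  then have "v $ 2 \<noteq> 0" using assms(1) by (auto simp: vec_eq_iff forall_2)
  then have "a = (a $ 2 / v $ 2) *\<^sub>R v"
    using assms(2) True by (auto simp: vec_eq_iff forall_2 cross_def)
  then show thesis by (rule that)
next
  case False
  then have "a = (a $ 1 / v $ 1) *\<^sub>R v"
    using assms(2) by (auto simp: vec_eq_iff forall_2 cross_def field_simps)
  then show thesis by (rule that)
qed

lemma aff_plus_eq: "aff_plus p q = {r. cross (q - p) r < cross (q - p) p}"
  unfolding aff_plus_def cross_def by (auto simp: algebra_simps)

lemma norm_axis: "norm (axis i a :: real^'n) = \<bar>a\<bar>"
  by (simp add: norm_eq_sqrt_inner inner_axis_axis)

section \<open>Translates through two points\<close>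

text \<open>
  All that is used of the body is that its interior \<open>C\<close> is a nonempty open set with compact closure,
  such that open segments between points of the closure run inside \<open>C\<close>.
\<close>

locale strictly_convex_range =
  fixes C :: "(real^2) set"
  assumes body: "interior_strictly_convex_body C"
begin

lemma open_range: "open C"
  and nonempty: "C \<noteq> {}"
  and compact_closure: "compact (closure C)"
  and strict_closure: "\<lbrakk>x \<in> closure C; y \<in> closure C; x \<noteq> y; 0 < t; t < 1\<rbrakk>
                         \<Longrightarrow> (1 - t) *\<^sub>R x + t *\<^sub>R y \<in> C"
proof -
  obtain K where K: "convex_body K" "strictly_convex K" "C = interior K"
    using body unfolding interior_strictly_convex_body_def by blast
  then have cl: "closure C = K"
    unfolding convex_body_def by (simp add: convex_closure_interior compact_imp_closed)
  show "open C" "C \<noteq> {}" "compact (closure C)"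
    using K cl unfolding convex_body_def by auto
  show "(1 - t) *\<^sub>R x + t *\<^sub>R y \<in> C"
    if "x \<in> closure C" "y \<in> closure C" "x \<noteq> y" "0 < t" "t < 1"
  proof -
    have "1 - t \<in> {0<..<1}" using that by simp
    then have "(1 - t) *\<^sub>R x + (1 - (1 - t)) *\<^sub>R y \<in> interior K"
      using K(2) that(1-3) unfolding strictly_convex_def cl by blast
    then show ?thesis using K(3) by simp
  qed
qed

lemma frontier_eq: "frontier C = closure C - C"
  using open_range by (simp add: frontier_def interior_open)

lemma frontierD: "x \<in> frontier C \<Longrightarrow> x \<in> closure C" "x \<in> frontier C \<Longrightarrow> x \<notin> C"
  by (auto simp: frontier_eq)

lemma compact_frontier: "compact (frontier C)"
  using compact_frontier_bounded[of C] compact_closure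
  by (meson bounded_subset closure_subset compact_imp_bounded)

lemma mix_in_range:
  assumes "x \<in> C" "y \<in> closure C" "0 \<le> t" "t < 1"
  shows "(1 - t) *\<^sub>R x + t *\<^sub>R y \<in> C"
proof (cases "x = y \<or> t = 0")
  case True
  then show ?thesis using assms by (auto simp flip: scaleR_add_left)
next
  case False
  then show ?thesis using assms strict_closure[of x y t] closure_subset by auto
qed


text \<open>
  A translate is handled through its centre, that is its translation vector. The condition is
  symmetric in \<open>p\<close> and \<open>q\<close>, which is what makes the ranges of \<open>(p, q)\<close> and \<open>(q, p)\<close> comparable.
\<close>

definition centres :: "real^2 \<Rightarrow> real^2 \<Rightarrow> (real^2) set" where
  "centres p q = {x. p - x \<in> frontier C \<and> q - x \<in> frontier C}"

lemma ranges_through_eq: "ranges_through C p q = (\<lambda>x. (+) x ` C) ` centres p q"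
  unfolding ranges_through_def translates_def centres_def
  by (auto simp: frontier_translate)

lemma chord_pairs_iff: "(p, q) \<in> chord_pairs C \<longleftrightarrow> p \<noteq> q \<and> centres p q \<noteq> {}"
  unfolding chord_pairs_def by (simp add: ranges_through_eq)

lemma compact_centres: "compact (centres p q)"
proof -
  have "centres p q = (\<lambda>a. p - a) ` (frontier C) \<inter> (\<lambda>a. q - a) ` (frontier C)"
  proof (intro set_eqI iffI)
    fix x assume "x \<in> centres p q"
    then show "x \<in> (\<lambda>a. p - a) ` frontier C \<inter> (\<lambda>a. q - a) ` frontier C"
      by (auto simp: centres_def image_iff intro: bexI[of _ "p - x"] bexI[of _ "q - x"])
  next
    fix x assume "x \<in> (\<lambda>a. p - a) ` frontier C \<inter> (\<lambda>a. q - a) ` frontier C"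
    then obtain a b where "a \<in> frontier C" "x = p - a" "b \<in> frontier C" "x = q - b" by blast
    then show "x \<in> centres p q" unfolding centres_def by (metis (no_types, lifting)
      add_diff_cancel_left' diff_add_cancel mem_Collect_eq add.commute)
  qed
  moreover have "compact ((\<lambda>a. w - a) ` (frontier C))" for w
    by (intro compact_continuous_image continuous_intros compact_frontier)
  ultimately show ?thesis by (simp add: compact_Int)
qed

text \<open>
  If a chord and a proper shift of it along its own line both had boundary endpoints, then the
  endpoint \<open>a + v\<close> would lie strictly between \<open>a\<close> and \<open>a + s *\<^sub>R v + v\<close>, hence inside \<open>C\<close>.
\<close>

lemma no_frontier_shift:
  assumes "a \<in> frontier C" "a + v \<in> frontier C" "a + s *\<^sub>R v \<in> frontier C"
    "a + s *\<^sub>R v + v \<in> frontier C" "v \<noteq> 0"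
  shows "\<not> s > 0"
proof
  assume "s > 0"
  \<comment> \<open>The weight with which \<open>a + v\<close> is a convex combination of the two outer endpoints.\<close>
  define t where "t = 1 / (1 + s)"
  have t: "0 < t" "t < 1" "t * (1 + s) = 1" using \<open>s > 0\<close> by (auto simp: t_def)
  have "(1 - t) *\<^sub>R a + t *\<^sub>R (a + s *\<^sub>R v + v) = a + (t * (1 + s)) *\<^sub>R v"
    by (simp add: algebra_simps)
  also have "\<dots> = a + v" by (simp add: t)
  finally have eq: "(1 - t) *\<^sub>R a + t *\<^sub>R (a + s *\<^sub>R v + v) = a + v" .
  have "a + s *\<^sub>R v + v = a + (1 + s) *\<^sub>R v" by (simp add: algebra_simps)
  then have "a \<noteq> a + s *\<^sub>R v + v" using assms(5) \<open>s > 0\<close> by auto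
  then have "a + v \<in> C" using strict_closure[of a "a + s *\<^sub>R v + v" t] t assms eq
    by (simp add: frontierD)
  then show False using assms(2) frontierD by blast
qed

text \<open>
  Equal values of \<open>cross (q - p)\<close> mean that the two centres differ by a multiple of \<open>q - p\<close>. Seen from
  the body, the chord has then been shifted along its own line.
\<close>

lemma centres_inj:
  assumes "x \<in> centres p q" "y \<in> centres p q" "p \<noteq> q" "cross (q - p) x = cross (q - p) y"
  shows "x = y"
proof -
  have "cross (q - p) (x - y) = 0" using assms by simp
  then obtain s where s: "x - y = s *\<^sub>R (q - p)"
    using parallel_if_cross_eq_0[of "q - p" "x - y"] assms(3) by auto
  have eqs: "p - y = (p - x) + s *\<^sub>R (q - p)" "q - y = (p - x) + s *\<^sub>R (q - p) + (q - p)"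
     "p - x = (p - y) + (- s) *\<^sub>R (q - p)" "q - x = (p - y) + (- s) *\<^sub>R (q - p) + (q - p)"
     "q - x = (p - x) + (q - p)" "q - y = (p - y) + (q - p)"
    using s by (simp_all add: algebra_simps)
  have fr: "p - x \<in> frontier C" "q - x \<in> frontier C" "p - y \<in> frontier C" "q - y \<in> frontier C"
    using assms by (auto simp: centres_def)
  have "\<not> s > 0"
    by (rule no_frontier_shift[of "p - x" "q - p"])
      (use fr eqs assms(3) in \<open>metis right_minus_eq\<close>)+
  moreover have "\<not> - s > 0"
    by (rule no_frontier_shift[of "p - y" "q - p"])
      (use fr eqs assms(3) in \<open>metis right_minus_eq\<close>)+
  ultimately have "s = 0" by simp
  with s show ?thesis by simp
qed

text \<open>
  Of three parallel chords of \<open>C\<close> of equal length, the convex combination of the outer two at the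
  level of the middle one has interior endpoints and the same length. So the line carrying the middle
  chord meets \<open>C\<close> in a segment that is strictly longer than this chord. With \<open>centres_inj\<close> it follows
  that at most two translates pass through two given points.
\<close>

lemma no_middle_centre:
  assumes "x \<in> centres p q" "y \<in> centres p q" "z \<in> centres p q"
    and "cross (q - p) x < cross (q - p) y" "cross (q - p) y < cross (q - p) z"
  shows False
proof -
  define f where "f = cross (q - p)"
  \<comment> \<open>The centre \<open>w\<close> is the point of the segment from \<open>x\<close> to \<open>z\<close> at the level of \<open>y\<close>.\<close>
  define t where "t = (f y - f x) / (f z - f x)"
  have t: "0 < t" "t < 1" using assms(4,5) by (auto simp: t_def f_def)
  have ne: "x \<noteq> z" using assms(4,5) by auto
  define w where "w = (1 - t) *\<^sub>R x + t *\<^sub>R z"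
  have fr: "p - x \<in> frontier C" "q - x \<in> frontier C" "p - y \<in> frontier C" "q - y \<in> frontier C"
      "p - z \<in> frontier C" "q - z \<in> frontier C"
    using assms by (auto simp: centres_def)
  have inner: "r - w \<in> C" if "r - x \<in> frontier C" "r - z \<in> frontier C" for r
  proof -
    have "r - w = (1 - t) *\<^sub>R (r - x) + t *\<^sub>R (r - z)" by (simp add: w_def algebra_simps)
    then show ?thesis using strict_closure[of "r - x" "r - z" t] that t ne frontierD by auto
  qed
  have pw: "p - w \<in> C" and qw: "q - w \<in> C" using inner fr by auto
  have "f w = f x + t * (f z - f x)" by (simp add: w_def f_def algebra_simps)
  also have "\<dots> = f y" using assms(4,5) by (simp add: t_def f_def)
  finally have "cross (q - p) (y - w) = 0" by (simp add: f_def)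
  moreover have "q - p \<noteq> 0" using assms(4) by (auto simp: cross_def)
  ultimately obtain s where s: "y - w = s *\<^sub>R (q - p)"
    using parallel_if_cross_eq_0 by metis
  then have y: "y = w + s *\<^sub>R (q - p)" by (simp add: algebra_simps)
  \<comment> \<open>The chord with centre \<open>w\<close> has interior endpoints; sliding along its own line by a nonzero
      amount makes one endpoint of the slid chord lie between an interior point and the closure.\<close>
  consider "s = 0" | "s > 0" | "s < 0" by linarith
  then show False
  proof cases
    case 1
    then show False using s pw fr frontierD by auto
  next
    case 2
    define u where "u = s / (1 + s)"
    have u: "0 \<le> u" "u < 1" "u * (1 + s) = s" using 2 by (auto simp: u_def)
    have "(1 - u) *\<^sub>R (q - w) + u *\<^sub>R (p - y) = (q - w) - (u * (1 + s)) *\<^sub>R (q - p)"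
    proof -
      have *: "p - y = (q - w) - (1 + s) *\<^sub>R (q - p)" using y by (simp add: algebra_simps)
      show ?thesis unfolding * by (simp add: algebra_simps)
    qed
    also have "\<dots> = q - y" unfolding u(3) y by (simp add: algebra_simps)
    finally have "q - y \<in> C" using mix_in_range[OF qw frontierD(1)[OF fr(3)] u(1,2)] by simp
    then show False using fr frontierD by blast
  next
    case 3
    define u where "u = - s / (1 - s)"
    have u: "0 \<le> u" "u < 1" "u * (1 - s) = - s" using 3 by (auto simp: u_def field_simps)
    have "(1 - u) *\<^sub>R (p - w) + u *\<^sub>R (q - y) = (p - w) + (u * (1 - s)) *\<^sub>R (q - p)"
    proof -
      have *: "q - y = (p - w) + (1 - s) *\<^sub>R (q - p)" using y by (simp add: algebra_simps)
      show ?thesis unfolding * by (simp add: algebra_simps)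
    qed
    also have "\<dots> = p - y" unfolding u(3) y by (simp add: algebra_simps)
    finally have "p - y \<in> C" using mix_in_range[OF pw frontierD(1)[OF fr(4)] u(1,2)] by simp
    then show False using fr frontierD by blast
  qed
qed

text \<open>
  Translating the range back to \<open>C\<close> turns its part inside \<open>aff_plus p q\<close> into the part of \<open>C\<close> on one
  side of a line parallel to \<open>q - p\<close>. Lowering \<open>cross (q - p)\<close> of the centre enlarges this part,
  and the strip that is gained contains the midpoint of the two copies of \<open>p\<close>, which lies in \<open>C\<close>, and
  therefore has positive area.
\<close>

lemma area_less:
  assumes "x \<in> centres p q" "y \<in> centres p q" "cross (q - p) x < cross (q - p) y"
  shows "measure lborel ((+) y ` C \<inter> aff_plus p q) < measure lborel ((+) x ` C \<inter> aff_plus p q)"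
proof -
  define f where "f = cross (q - p)"
  have cont: "continuous_on UNIV f" unfolding f_def by (intro continuous_intros)
  define H where "H c = C \<inter> {z. f z < c}" for c
  have openH: "open (H c)" for c
    unfolding H_def by (intro open_Int open_range open_Collect_less cont continuous_intros)
  have bounded: "bounded C" using compact_closure by (meson bounded_subset closure_subset compact_imp_bounded)
  have area: "measure lborel ((+) w ` C \<inter> aff_plus p q) = measure lebesgue (H (f p - f w))" for w
  proof -
    have eq: "(+) w ` C \<inter> aff_plus p q = (+) w ` H (f p - f w)"
      unfolding set_eq_iff by (auto simp: mem_translate aff_plus_eq H_def f_def)
    have "open ((+) w ` H (f p - f w))" using openH by (simp add: open_translation)
    then have "(+) w ` H (f p - f w) \<in> sets borel" by simp
    then show ?thesis unfolding eq by (simp add: measure_translation flip: measure_completion)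
  qed
  define a b where "a = f p - f x" and "b = f p - f y"
  have "b < a" using assms(3) by (simp add: a_def b_def f_def)
  define L where "L = C \<inter> {z. b < f z} \<inter> {z. f z < a}"
  have "open L" unfolding L_def
    by (intro open_Int open_range open_Collect_less cont continuous_intros)
  have "L \<noteq> {}"
  proof -
    define m where "m = (1 - 1/2) *\<^sub>R (p - x) + (1/2) *\<^sub>R (p - y)"
    have "p - x \<noteq> p - y" using assms(3) by auto
    then have "m \<in> C" unfolding m_def
      using assms by (intro strict_closure) (auto simp: centres_def frontierD)
    moreover have "f m = (a + b) / 2"
      unfolding m_def f_def a_def b_def cross_add cross_scaleR cross_diff by argo
    ultimately have "m \<in> L" using \<open>b < a\<close> by (auto simp: L_def)
    then show ?thesis by blast
  qed
  have fm: "H c \<in> lmeasurable" "L \<in> lmeasurable" for c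
    using openH \<open>open L\<close> bounded by (auto intro!: bounded_set_imp_lmeasurable
       intro: bounded_subset[OF bounded] simp: H_def L_def)
  have "measure lebesgue L > 0"
    using open_not_negligible[OF \<open>open L\<close> \<open>L \<noteq> {}\<close>] fm(2)
    by (metis measure_nonneg negligible_iff_measure order_le_less)
  moreover have "measure lebesgue (H b \<union> L) = measure lebesgue (H b) + measure lebesgue L"
    using fm by (intro measure_Un2[THEN trans]) (auto simp: H_def L_def intro!: arg_cong[where f="measure lebesgue"])
  moreover have "measure lebesgue (H b \<union> L) \<le> measure lebesgue (H a)"
    using fm \<open>b < a\<close> by (intro measure_mono_fmeasurable) (auto simp: H_def L_def fmeasurable.Un fmeasurableD)
  ultimately show ?thesis unfolding area a_def[symmetric] b_def[symmetric] by linarith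
qed

section \<open>The distinguished translate through two points\<close>

text \<open>
  Minimising a continuous function replaces maximising an area. Compactness gives existence, and
  the minimiser is unique by \<open>centres_inj\<close>.
\<close>

definition edge_centre :: "real^2 \<Rightarrow> real^2 \<Rightarrow> real^2" where
  "edge_centre p q = (SOME x. x \<in> centres p q \<and> (\<forall>y\<in>centres p q. cross (q - p) x \<le> cross (q - p) y))"

lemma edge_centre:
  assumes "(p, q) \<in> chord_pairs C"
  shows "edge_centre p q \<in> centres p q"
    and "y \<in> centres p q \<Longrightarrow> cross (q - p) (edge_centre p q) \<le> cross (q - p) y"
proof -
  have "\<exists>x\<in>centres p q. \<forall>y\<in>centres p q. cross (q - p) x \<le> cross (q - p) y"
    using assms by (intro continuous_attains_inf compact_centres continuous_intros)
      (auto simp: chord_pairs_iff)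
  then have "\<exists>x. x \<in> centres p q \<and> (\<forall>y\<in>centres p q. cross (q - p) x \<le> cross (q - p) y)"
    by blast
  then have "edge_centre p q \<in> centres p q \<and>
     (\<forall>y\<in>centres p q. cross (q - p) (edge_centre p q) \<le> cross (q - p) y)"
    unfolding edge_centre_def by (rule someI_ex)
  then show "edge_centre p q \<in> centres p q"
     "y \<in> centres p q \<Longrightarrow> cross (q - p) (edge_centre p q) \<le> cross (q - p) y" by auto
qed

lemma edge_range_eq:
  assumes "(p, q) \<in> chord_pairs C"
  shows "edge_range C p q = (+) (edge_centre p q) ` C"
proof -
  have pq: "p \<noteq> q" using assms by (simp add: chord_pairs_iff)
  have less: "measure lborel ((+) y ` C \<inter> aff_plus p q)
       < measure lborel ((+) (edge_centre p q) ` C \<inter> aff_plus p q)"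
    if "y \<in> centres p q" "y \<noteq> edge_centre p q" for y
  proof (rule area_less)
    show "cross (q - p) (edge_centre p q) < cross (q - p) y"
      using that edge_centre[OF assms] centres_inj[OF _ _ pq] by (metis order_le_less)
  qed (use that edge_centre[OF assms] in auto)
  show ?thesis unfolding edge_range_def ranges_through_eq
  proof (rule the_equality)
    show "is_arg_max (\<lambda>Q. measure lborel (Q \<inter> aff_plus p q))
      (\<lambda>Q. Q \<in> (\<lambda>x. (+) x ` C) ` centres p q) ((+) (edge_centre p q) ` C)"
      using less edge_centre(1)[OF assms] unfolding is_arg_max_linorder
      by (metis (no_types, lifting) image_iff less_imp_le order_refl)
  next
    fix Q assume "is_arg_max (\<lambda>Q. measure lborel (Q \<inter> aff_plus p q))
      (\<lambda>Q. Q \<in> (\<lambda>x. (+) x ` C) ` centres p q) Q"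
    then show "Q = (+) (edge_centre p q) ` C"
      using less edge_centre(1)[OF assms] unfolding is_arg_max_linorder
      by (metis (no_types, lifting) image_iff leD)
  qed
qed

lemma k_edge_frontier:
  assumes "(p, q) \<in> chord_pairs C"
  shows "p \<notin> edge_range C p q" "q \<notin> edge_range C p q"
  using edge_centre(1)[OF assms] frontierD
  by (auto simp: edge_range_eq[OF assms] mem_translate centres_def)

lemma centres_commute: "centres q p = centres p q"
  by (auto simp: centres_def)

text \<open>
  Exchanging \<open>p\<close> and \<open>q\<close> negates \<open>cross (q - p)\<close>, so the two orders of the pair select the centre
  with the smallest and the one with the largest value. By \<open>no_middle_centre\<close> there is no other.
\<close>

lemma ranges_through_cases:
  assumes "p \<noteq> q" "Q \<in> ranges_through C p q"
  shows "(p, q) \<in> chord_pairs C" "(q, p) \<in> chord_pairs C"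
    "Q = edge_range C p q \<or> Q = edge_range C q p"
proof -
  show pq: "(p, q) \<in> chord_pairs C" and qp: "(q, p) \<in> chord_pairs C"
    using assms by (auto simp: chord_pairs_iff ranges_through_eq centres_commute[of q p])
  obtain y where y: "y \<in> centres p q" "Q = (+) y ` C"
    using assms by (auto simp: ranges_through_eq)
  have max: "cross (q - p) y \<le> cross (q - p) (edge_centre q p)"
    using edge_centre(2)[OF qp, of y] y(1) cross_minus_left[of "q - p"]
    by (simp add: centres_commute[of q p])
  have "edge_centre q p \<in> centres p q" using edge_centre(1)[OF qp] by (simp add: centres_commute)
  then have "y = edge_centre p q \<or> y = edge_centre q p"
    using max edge_centre[OF pq] y(1) no_middle_centre centres_inj[OF _ _ assms(1)]
    by (metis order_le_less)
  then show "Q = edge_range C p q \<or> Q = edge_range C q p"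
    using y(2) edge_range_eq pq qp by auto
qed

section \<open>From ranges cutting off a set to ranges through two points\<close>

text \<open>
  The lowest point of the closure of \<open>C\<close>. It describes the topmost translate whose closure contains
  a given point \<open>p\<close>: its centre is \<open>p - bottom\<close>.
\<close>

definition bottom :: "real^2" where
  "bottom = (SOME c. c \<in> closure C \<and> (\<forall>z\<in>closure C. z \<noteq> c \<longrightarrow> c $ 2 < z $ 2))"

lemma bottom: "bottom \<in> closure C" "\<And>z. z \<in> closure C \<Longrightarrow> z \<noteq> bottom \<Longrightarrow> bottom $ 2 < z $ 2"
proof -
  have "\<exists>c\<in>closure C. \<forall>z\<in>closure C. c $ 2 \<le> z $ 2"
    by (intro continuous_attains_inf compact_closure continuous_intros) (use nonempty in auto)
  then obtain c where c: "c \<in> closure C" "\<And>z. z \<in> closure C \<Longrightarrow> c $ 2 \<le> z $ 2" by blast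
  have "c $ 2 < z $ 2" if z: "z \<in> closure C" "z \<noteq> c" for z
  proof (rule ccontr)
    assume "\<not> c $ 2 < z $ 2"
    then have eq: "z $ 2 = c $ 2" using c(2)[OF z(1)] by simp
    define m where "m = (1 - 1/2) *\<^sub>R c + (1/2) *\<^sub>R z"
    have "m \<in> C" unfolding m_def using c z by (intro strict_closure) auto
    then obtain e where e: "e > 0" "ball m e \<subseteq> C"
      using open_range open_contains_ball by metis
    have "m - axis 2 (e/2) \<in> ball m e" using e(1) by (simp add: dist_norm norm_axis)
    then have "m - axis 2 (e/2) \<in> closure C" using e closure_subset by blast
    then show False using c(2)[of "m - axis 2 (e/2)"] eq e(1) by (simp add: m_def axis_def)
  qed
  with c(1) have "\<exists>c. c \<in> closure C \<and> (\<forall>z\<in>closure C. z \<noteq> c \<longrightarrow> c $ 2 < z $ 2)" by blast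
  from someI_ex[OF this]
  show "bottom \<in> closure C" "\<And>z. z \<in> closure C \<Longrightarrow> z \<noteq> bottom \<Longrightarrow> bottom $ 2 < z $ 2"
    by (auto simp: bottom_def)
qed

text \<open>
  The closure in the second condition makes this set open. It reflects that no point of \<open>S\<close> may lie
  on the boundary of a range that cuts off a set from \<open>S\<close>.
\<close>

definition cell :: "(real^2) set \<Rightarrow> (real^2) set \<Rightarrow> (real^2) set" where
  "cell A B = {x. (\<forall>p\<in>A. p - x \<in> C) \<and> (\<forall>p\<in>B. p - x \<notin> closure C)}"

lemma open_cell:
  assumes "finite A" "finite B"
  shows "open (cell A B)"
proof -
  have "cell A B = (\<Inter>p\<in>A. (\<lambda>x. p - x) -` C) \<inter> (\<Inter>p\<in>B. (\<lambda>x. p - x) -` (- closure C))"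
    by (auto simp: cell_def)
  moreover have "open ((\<lambda>x. p - x) -` U)" if "open U" for p and U :: "(real^2) set"
    using that by (intro open_vimage continuous_intros)
  ultimately show ?thesis
    using assms open_range by (simp add: open_INT open_Int open_Compl)
qed

lemma closure_cell:
  assumes "x \<in> closure (cell A B)"
  shows "p \<in> A \<Longrightarrow> p - x \<in> closure C" "p \<in> B \<Longrightarrow> p - x \<notin> C"
proof -
  have cl: "closed ((\<lambda>x. p - x) -` F)" if "closed F" for F :: "(real^2) set"
    using that by (intro closed_vimage continuous_intros)
  show "p - x \<in> closure C" if "p \<in> A"
  proof -
    have "closure (cell A B) \<subseteq> (\<lambda>x. p - x) -` closure C"
      using that closure_subset by (intro closure_minimal cl) (auto simp: cell_def)
    then show ?thesis using assms by auto
  qed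
  show "p - x \<notin> C" if "p \<in> B"
  proof -
    have "x \<notin> cell A B" if "p - x \<in> C" for x
      using that \<open>p \<in> B\<close> closure_subset[of C] by (auto simp: cell_def)
    then have "closure (cell A B) \<subseteq> (\<lambda>x. p - x) -` (- C)"
      using open_range by (intro closure_minimal cl) auto
    then show ?thesis using assms by auto
  qed
qed

lemma compact_closure_cell:
  assumes "A \<noteq> {}"
  shows "compact (closure (cell A B))"
proof -
  obtain p where p: "p \<in> A" using assms by blast
  have comp: "compact ((\<lambda>a. p - a) ` closure C)"
    by (intro compact_continuous_image continuous_intros compact_closure)
  have "x \<in> (\<lambda>a. p - a) ` closure C" if "x \<in> closure (cell A B)" for x
    using closure_cell(1)[OF that p] by (intro image_eqI[of _ _ "p - x"]) auto
  then have "closure (cell A B) = (\<lambda>a. p - a) ` closure C \<inter> closure (cell A B)" by auto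
  then show ?thesis using compact_Int_closed[OF comp, of "closure (cell A B)"] by simp
qed

text \<open>
  If the points just below \<open>z\<close> all belong to the closure of \<open>C\<close>, then so do the points immediately to
  the left and to the right of \<open>z\<close>, as limits. By strict convexity \<open>z\<close>, their midpoint, is interior.
  This excludes that the topmost point of a cell is caused by a single point outside the range.
\<close>

lemma no_half_disc_at_frontier:
  assumes "z \<in> frontier C" "e > 0"
    and "\<And>y. y \<in> ball 0 e \<Longrightarrow> y $ 2 > 0 \<Longrightarrow> z - y \<in> closure C"
  shows False
proof -
  have side: "z - axis 1 d \<in> closure C" if d: "\<bar>d\<bar> \<le> e / 2" for d
  proof -
    have "(axis 1 d :: real^2) \<in> closure {y \<in> ball 0 e. y $ 2 > 0}"
      unfolding closure_approachable
    proof (intro allI impI)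
      fix h :: real assume h: "h > 0"
      define g where "g = min h e / 4"
      have g: "0 < g" "g < h" "g < e / 2" using h assms(2) by (auto simp: g_def)
      have "norm (axis 1 d + axis 2 g :: real^2) \<le> norm (axis 1 d :: real^2) + norm (axis 2 g :: real^2)"
        by (rule norm_triangle_ineq)
      also have "\<dots> < e" using g d by (simp add: norm_axis)
      finally have "axis 1 d + axis 2 g \<in> {y \<in> ball 0 e. (y::real^2) $ 2 > 0}"
        using g by (simp add: axis_def)
      moreover have "dist (axis 1 d + axis 2 g) (axis 1 d :: real^2) < h"
        using g by (simp add: dist_norm norm_axis)
      ultimately show "\<exists>y\<in>{y \<in> ball 0 e. (y::real^2) $ 2 > 0}. dist y (axis 1 d) < h" by blast
    qed
    moreover have "closure {y \<in> ball 0 e. (y::real^2) $ 2 > 0} \<subseteq> (\<lambda>y. z - y) -` closure C"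
      using assms(3) by (intro closure_minimal closed_vimage continuous_intros) auto
    ultimately show ?thesis by auto
  qed
  have "(1 - 1/2) *\<^sub>R (z - axis 1 (e/2)) + (1/2) *\<^sub>R (z - axis 1 (- (e/2))) \<in> C"
    using assms(2) by (intro strict_closure side) (auto simp: vec_eq_iff axis_def)
  also have "(1 - 1/2) *\<^sub>R (z - axis 1 (e/2)) + (1/2) *\<^sub>R (z - axis 1 (- (e/2))) = z"
    by (simp add: vec_eq_iff axis_def field_simps)
  finally show False using assms(1) frontierD by blast
qed

text \<open>
  The witness is a topmost point \<open>x\<close> of the closure of the cell of \<open>T\<close>. Let \<open>Z\<close> consist of the points of
  \<open>S\<close> on the boundary of the translate with centre \<open>x\<close>. Near \<open>x\<close> only the constraints coming from \<open>Z\<close>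
  matter. If \<open>Z\<close> is empty, one can move up inside the cell. If \<open>Z = {p}\<close> with \<open>p \<in> T\<close>, then near \<open>x\<close> the
  cell coincides with the convex set of centres whose translate contains \<open>p\<close>, so \<open>x\<close> is the top of
  that set. If \<open>Z = {p}\<close> with \<open>p \<notin> T\<close>, there would be a half disc as in \<open>no_half_disc_at_frontier\<close>.
\<close>

lemma extreme_centre:
  assumes S: "finite S" "T \<subseteq> S" "T \<noteq> {}" and x0: "x0 \<in> cell T (S - T)"
  obtains x where "\<And>p. p \<in> T \<Longrightarrow> p - x \<in> closure C" "\<And>p. p \<in> S - T \<Longrightarrow> p - x \<notin> C"
    "(\<exists>p\<in>T. x = p - bottom \<and> {p\<in>S. p - x \<in> frontier C} = {p}) \<or>
     (\<exists>p\<in>S. \<exists>q\<in>S. p \<noteq> q \<and> p - x \<in> frontier C \<and> q - x \<in> frontier C)"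
proof -
  define W where "W = cell T (S - T)"
  have "\<exists>x\<in>closure W. \<forall>y\<in>closure W. y $ 2 \<le> x $ 2"
    using x0 S(3) unfolding W_def
    by (intro continuous_attains_sup compact_closure_cell continuous_intros)
       (use closure_subset in blast)+
  then obtain x where x: "x \<in> closure W" and "\<And>y. y \<in> closure W \<Longrightarrow> y $ 2 \<le> x $ 2" by blast
  then have top: "y $ 2 \<le> x $ 2" if "y \<in> W" for y using that closure_subset by blast
  note cl = closure_cell[OF x[unfolded W_def]]
  define Z where "Z = {p\<in>S. p - x \<in> frontier C}"
  define N where "N = cell (T - Z) (S - T - Z)"
  have "open N" unfolding N_def using S by (intro open_cell) (auto intro: finite_subset)
  moreover have "x \<in> N"
    using cl S(2) unfolding N_def cell_def by (auto simp: Z_def frontier_eq)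
  ultimately obtain e where e: "e > 0" "ball x e \<subseteq> N" using open_contains_ball by metis
  have "Z \<noteq> {}"
  proof
    assume "Z = {}"
    then have "N = W" by (simp add: N_def W_def)
    moreover have "x + axis 2 (e/2) \<in> ball x e" using e by (simp add: dist_norm norm_axis)
    ultimately have "x + axis 2 (e/2) \<in> W" using e(2) by blast
    then show False using top[of "x + axis 2 (e/2)"] e(1) by (simp add: axis_def)
  qed
  then obtain p where p: "p \<in> Z" by blast
  have main: "p \<in> T \<and> x = p - bottom" if Z: "Z = {p}"
  proof (cases "p \<in> T")
    case True
    have inW: "y \<in> W" if "y \<in> ball x e" "p - y \<in> C" for y
      using that e(2) True unfolding W_def N_def Z cell_def by auto
    have "p - x = bottom"
    proof (rule ccontr)
      assume ne: "p - x \<noteq> bottom"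
      define d where "d = p - x - bottom"
      have px: "p - x \<in> closure C" using p by (simp add: Z_def frontierD)
      have d: "d $ 2 > 0" using bottom(2)[OF px ne] by (simp add: d_def)
      have "d \<noteq> 0" using d by auto
      \<comment> \<open>Moving \<open>x\<close> a little towards \<open>p - bottom\<close> keeps \<open>p\<close> inside and raises the centre.\<close>
      define t where "t = min (1/2) (e / (2 * norm d))"
      have t: "0 < t" "t < 1" using e(1) \<open>d \<noteq> 0\<close> by (auto simp: t_def)
      have "t * norm d \<le> e / (2 * norm d) * norm d" by (intro mult_right_mono) (auto simp: t_def)
      also have "\<dots> < e" using e(1) \<open>d \<noteq> 0\<close> by simp
      finally have "x + t *\<^sub>R d \<in> ball x e" using t by (simp add: dist_norm norm_axis)
      moreover have "p - (x + t *\<^sub>R d) = (1 - t) *\<^sub>R (p - x) + t *\<^sub>R bottom"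
        by (simp add: d_def algebra_simps)
      then have "p - (x + t *\<^sub>R d) \<in> C" using strict_closure[OF px bottom(1) ne t] by simp
      ultimately have "x + t *\<^sub>R d \<in> W" using inW by blast
      then show False using top[of "x + t *\<^sub>R d"] t d by (simp add: mult_le_0_iff)
    qed
    then show ?thesis using True by (auto simp: algebra_simps)
  next
    case False
    have "p - x - y \<in> closure C" if y: "y \<in> ball 0 e" "y $ 2 > 0" for y
    proof (rule ccontr)
      assume out: "p - x - y \<notin> closure C"
      have "x + y \<in> N" using e(2) y by (auto simp: dist_norm)
      then have "x + y \<in> W" using out False p unfolding W_def N_def Z cell_def
        by (auto simp: diff_diff_eq Z_def)
      then show False using top[of "x + y"] y by simp
    qed
    then show ?thesis using no_half_disc_at_frontier[of "p - x" e] p e(1) by (auto simp: Z_def)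
  qed
  show thesis
  proof (rule that[of x])
    show "p - x \<in> closure C" if "p \<in> T" for p using cl(1) that .
    show "p - x \<notin> C" if "p \<in> S - T" for p using cl(2) that .
    show "(\<exists>p\<in>T. x = p - bottom \<and> {p\<in>S. p - x \<in> frontier C} = {p}) \<or>
     (\<exists>p\<in>S. \<exists>q\<in>S. p \<noteq> q \<and> p - x \<in> frontier C \<and> q - x \<in> frontier C)"
    proof (cases "Z = {p}")
      case True
      then show ?thesis using main by (auto simp: Z_def)
    next
      case False
      then obtain q where "q \<in> Z" "q \<noteq> p" using p by blast
      then show ?thesis using p unfolding Z_def by blast
    qed
  qed
qed

lemma finite_k_edges: "finite S \<Longrightarrow> finite (k_edges C m S)"
  by (rule finite_subset[of _ "S \<times> S"]) (auto simp: k_edges_def)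

definition general_position :: "(real^2) set \<Rightarrow> bool" where
  "general_position S \<longleftrightarrow> (\<forall>Q\<in>translates C. \<forall>p\<in>S. \<forall>q\<in>S. \<forall>r\<in>S.
     {p, q, r} \<subseteq> frontier Q \<longrightarrow> p = q \<or> q = r \<or> p = r)"

lemma k_sets_iff:
  assumes "finite S"
  shows "T \<in> k_sets C k S \<longleftrightarrow> T \<subseteq> S \<and> card T = k \<and> cell T (S - T) \<noteq> {}"
proof -
  have "(S \<inter> frontier ((+) x ` C) = {} \<and> T = S \<inter> (+) x ` C) \<longleftrightarrow> x \<in> cell T (S - T)"
    if "T \<subseteq> S" for x
    using that closure_subset[of C] unfolding cell_def set_eq_iff
    by (auto simp: frontier_translate mem_translate frontier_eq simp del: image_iff)
  then show ?thesis unfolding k_sets_def translates_def by blast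
qed

text \<open>
  The two parts of the right-hand side correspond to the two cases of \<open>extreme_centre\<close>. In the second
  case a set of \<open>k\<close> points differs from the trace of the range \<open>Q\<close> through two points by a subset of
  these points, so \<open>Q\<close> contains \<open>k - 2\<close>, \<open>k - 1\<close> or \<open>k\<close> points of \<open>S\<close>.
\<close>

lemma k_sets_subset:
  assumes S: "finite S" and gp: "general_position S" and k: "1 \<le> k"
  shows "k_sets C k S \<subseteq> (\<lambda>p. insert p (S \<inter> (+) (p - bottom) ` C)) ` S \<union>
    (\<Union>m\<in>{k-2..k}. \<Union>e\<in>k_edges C m S.
        (\<lambda>U. (S \<inter> edge_range C (fst e) (snd e)) \<union> U) ` Pow {fst e, snd e})"
proof
  fix T assume "T \<in> k_sets C k S"
  then have T: "T \<subseteq> S" "card T = k" and "cell T (S - T) \<noteq> {}" using k_sets_iff[OF S] by auto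
  then obtain x0 where x0: "x0 \<in> cell T (S - T)" by blast
  have "T \<noteq> {}" using T(2) k by auto
  from extreme_centre[OF S T(1) this x0] obtain x
    where x: "\<And>p. p \<in> T \<Longrightarrow> p - x \<in> closure C" "\<And>p. p \<in> S - T \<Longrightarrow> p - x \<notin> C"
    and cases: "(\<exists>p\<in>T. x = p - bottom \<and> {p\<in>S. p - x \<in> frontier C} = {p}) \<or>
     (\<exists>p\<in>S. \<exists>q\<in>S. p \<noteq> q \<and> p - x \<in> frontier C \<and> q - x \<in> frontier C)" by blast
  have sub: "S \<inter> (+) x ` C \<subseteq> T" using x(2) mem_translate[of _ x C] by blast
  have sup: "T \<subseteq> (S \<inter> (+) x ` C) \<union> {p\<in>S. p - x \<in> frontier C}"
    using x(1) T(1) mem_translate[of _ x C] by (auto simp: frontier_eq)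
  let ?B = "\<lambda>e. (\<lambda>U. (S \<inter> edge_range C (fst e) (snd e)) \<union> U) ` Pow {fst e, snd e}"
  from cases consider
    (one) p where "p \<in> T" "x = p - bottom" "{p\<in>S. p - x \<in> frontier C} = {p}"
  | (two) p q where "p \<in> S" "q \<in> S" "p \<noteq> q" "p - x \<in> frontier C" "q - x \<in> frontier C" by blast
  then show "T \<in> (\<lambda>p. insert p (S \<inter> (+) (p - bottom) ` C)) ` S \<union>
    (\<Union>m\<in>{k-2..k}. \<Union>e\<in>k_edges C m S. ?B e)"
  proof cases
    case one
    then have "T = insert p (S \<inter> (+) (p - bottom) ` C)" using sub sup by auto
    then show ?thesis using one(1) T(1) by blast
  next
    case two
    define R where "R = (+) x ` C"
    have R: "R \<in> translates C" by (auto simp: R_def translates_def)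
    have pqR: "p \<in> frontier R" "q \<in> frontier R" using two by (auto simp: R_def frontier_translate)
    have notin: "p \<notin> R" "q \<notin> R" using two frontierD by (auto simp: R_def mem_translate)
    have "r = p \<or> r = q" if "r \<in> S" "r - x \<in> frontier C" for r
    proof -
      have "{p, q, r} \<subseteq> frontier R" using pqR that by (auto simp: R_def frontier_translate)
      then show ?thesis using gp R two that unfolding general_position_def by blast
    qed
    then have TU: "T = (S \<inter> R) \<union> (T \<inter> {p, q})" using sub sup unfolding R_def by blast
    have "finite (S \<inter> R)" using S by simp
    then have "card T = card (S \<inter> R) + card (T \<inter> {p, q})"
      using notin by (subst TU, subst card_Un_disjoint) (auto intro: finite_subset)
    moreover have "card (T \<inter> {p, q}) \<le> card {p, q}" by (intro card_mono) auto
    ultimately have m: "card (S \<inter> R) \<in> {k-2..k}" using T(2) two(3) by auto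
    have thr: "R \<in> ranges_through C p q" using R pqR by (simp add: ranges_through_def)
    note c = ranges_through_cases[OF two(3) thr]
    have "\<exists>e\<in>k_edges C (card (S \<inter> R)) S. T \<in> ?B e"
      using c(3)
    proof
      assume eq: "R = edge_range C p q"
      have "(p, q) \<in> k_edges C (card (S \<inter> R)) S" using c(1) two eq by (simp add: k_edges_def)
      moreover have "T \<in> ?B (p, q)" using TU eq by (intro image_eqI[of _ _ "T \<inter> {p, q}"]) auto
      ultimately show ?thesis by blast
    next
      assume eq: "R = edge_range C q p"
      have "(q, p) \<in> k_edges C (card (S \<inter> R)) S" using c(2) two eq by (simp add: k_edges_def)
      moreover have "T \<in> ?B (q, p)" using TU eq by (intro image_eqI[of _ _ "T \<inter> {p, q}"]) auto
      ultimately show ?thesis by blast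
    qed
    then show ?thesis using m by blast
  qed
qed

text \<open>
  Every edge accounts for at most four sets, one for each subset of its two endpoints.
\<close>

lemma card_k_sets_le:
  assumes S: "finite S" and gp: "general_position S" and k: "1 \<le> k"
  shows "card (k_sets C k S) \<le> card S + (\<Sum>m\<in>{k-2..k}. 4 * card (k_edges C m S))"
proof -
  let ?A = "(\<lambda>p. insert p (S \<inter> (+) (p - bottom) ` C)) ` S"
  let ?B = "\<lambda>e. (\<lambda>U. (S \<inter> edge_range C (fst e) (snd e)) \<union> U) ` Pow {fst e, snd e}"
  have fin: "finite (?A \<union> (\<Union>m\<in>{k-2..k}. \<Union>e\<in>k_edges C m S. ?B e))"
    using S finite_k_edges[OF S] by auto
  have B: "card (?B e) \<le> 4" for e
  proof -
    have "card (?B e) \<le> card (Pow {fst e, snd e})" by (intro card_image_le) auto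
    also have "\<dots> \<le> 4" by (cases "fst e = snd e") (auto simp: card_Pow)
    finally show ?thesis .
  qed
  have "card (k_sets C k S) \<le> card (?A \<union> (\<Union>m\<in>{k-2..k}. \<Union>e\<in>k_edges C m S. ?B e))"
    by (intro card_mono fin k_sets_subset assms)
  also have "\<dots> \<le> card ?A + card (\<Union>m\<in>{k-2..k}. \<Union>e\<in>k_edges C m S. ?B e)"
    by (rule card_Un_le)
  also have "card ?A \<le> card S" using S by (rule card_image_le)
  also have "card (\<Union>m\<in>{k-2..k}. \<Union>e\<in>k_edges C m S. ?B e)
      \<le> (\<Sum>m\<in>{k-2..k}. card (\<Union>e\<in>k_edges C m S. ?B e))"
    by (rule card_UN_le) auto
  also have "\<dots> \<le> (\<Sum>m\<in>{k-2..k}. 4 * card (k_edges C m S))"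
  proof (rule sum_mono)
    fix m
    have "card (\<Union>e\<in>k_edges C m S. ?B e) \<le> (\<Sum>e\<in>k_edges C m S. card (?B e))"
      by (rule card_UN_le[OF finite_k_edges[OF S]])
    also have "\<dots> \<le> (\<Sum>e\<in>k_edges C m S. 4)" by (intro sum_mono B)
    finally show "card (\<Union>e\<in>k_edges C m S. ?B e) \<le> 4 * card (k_edges C m S)" by simp
  qed
  finally show ?thesis by simp
qed

section \<open>Borel measurability of the distinguished translate\<close>

text \<open>
  The centres for \<open>(p, q)\<close> stay at bounded distance from \<open>p\<close>: writing a centre as \<open>p - a\<close> with \<open>a\<close> in
  the compact boundary of \<open>C\<close> turns this into a projection along a compact set, which is closed.
\<close>

lemma closed_centre_projection:
  assumes "closed R"
  shows "closed {pq. \<exists>x\<in>centres (fst pq) (snd pq). (pq, x) \<in> R}"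
proof -
  define T where "T = {z :: (real^2) \<times> ((real^2) \<times> (real^2)).
    snd (snd z) - (fst (snd z) - fst z) \<in> frontier C \<and> (snd z, fst (snd z) - fst z) \<in> R}"
  have "closed T"
    unfolding T_def
    by (intro closed_Collect_conj)
       (use assms in \<open>auto intro!: closed_vimage[unfolded vimage_def] continuous_intros simp: frontier_closed\<close>)
  then have "closed {pq. \<exists>a. a \<in> frontier C \<and> (a, pq) \<in> T}"
    by (rule closed_compact_projection[OF compact_frontier])
  also have "{pq. \<exists>a. a \<in> frontier C \<and> (a, pq) \<in> T} =
      {pq. \<exists>x\<in>centres (fst pq) (snd pq). (pq, x) \<in> R}"
  proof (intro Collect_cong iffI)
    fix pq assume "\<exists>a. a \<in> frontier C \<and> (a, pq) \<in> T"
    then show "\<exists>x\<in>centres (fst pq) (snd pq). (pq, x) \<in> R"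
      by (force simp: T_def centres_def)
  next
    fix pq assume "\<exists>x\<in>centres (fst pq) (snd pq). (pq, x) \<in> R"
    then obtain x where "x \<in> centres (fst pq) (snd pq)" "(pq, x) \<in> R" by blast
    then show "\<exists>a. a \<in> frontier C \<and> (a, pq) \<in> T"
      by (intro exI[of _ "fst pq - x"]) (auto simp: T_def centres_def)
  qed
  finally show ?thesis .
qed

lemma borel_chord_pairs: "chord_pairs C \<in> sets borel"
proof -
  have "closed {pq. \<exists>x\<in>centres (fst pq) (snd pq). (pq, x) \<in> UNIV}"
    by (rule closed_centre_projection) simp
  moreover have "open {pq :: (real^2) \<times> (real^2). fst pq \<noteq> snd pq}"
    by (intro open_Collect_neq continuous_intros)
  moreover have "chord_pairs C = {pq. fst pq \<noteq> snd pq} \<inter>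
      {pq. \<exists>x\<in>centres (fst pq) (snd pq). (pq, x) \<in> UNIV}"
    using chord_pairs_iff by auto
  ultimately show ?thesis by simp
qed

text \<open>
  The centre lies in \<open>Z\<close> if and only if the minimum of \<open>cross (q - p)\<close> over all centres agrees with its
  minimum over the centres in \<open>Z\<close>. Comparing the two minima through rational bounds expresses this by
  countably many implications between conditions on \<open>(p, q)\<close> that are closed by
  \<open>closed_centre_projection\<close>.
\<close>

lemma edge_centre_in_closed_iff:
  assumes "(p, q) \<in> chord_pairs C" "closed Z"
  shows "edge_centre p q \<in> Z \<longleftrightarrow> (\<forall>t\<in>\<rat>.
     (\<exists>x\<in>centres p q. cross (q - p) x \<le> t) \<longrightarrow> (\<exists>x\<in>centres p q. x \<in> Z \<and> cross (q - p) x \<le> t))"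
    (is "_ = ?R")
proof
  note e = edge_centre[OF assms(1)]
  show ?R if "edge_centre p q \<in> Z" using that e by (meson order_trans)
  assume R: ?R
  obtain t where t: "t \<in> \<rat>" "cross (q - p) (edge_centre p q) < t"
    using Rats_dense_in_real[of "cross (q - p) (edge_centre p q)" "cross (q - p) (edge_centre p q) + 1"] by auto
  then have "centres p q \<inter> Z \<noteq> {}" using R e(1) by (metis Int_iff empty_iff less_imp_le)
  moreover have "compact (centres p q \<inter> Z)" using compact_centres assms(2) by (rule compact_Int_closed)
  ultimately obtain x where x: "x \<in> centres p q \<inter> Z"
      "\<And>y. y \<in> centres p q \<inter> Z \<Longrightarrow> cross (q - p) x \<le> cross (q - p) y"
    using continuous_attains_inf[of "centres p q \<inter> Z" "cross (q - p)"]
      continuous_on_cross[OF continuous_on_const continuous_on_id] by metis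
  have "\<not> cross (q - p) (edge_centre p q) < cross (q - p) x"
  proof
    assume "cross (q - p) (edge_centre p q) < cross (q - p) x"
    then obtain t where "t \<in> \<rat>" "cross (q - p) (edge_centre p q) < t" "t < cross (q - p) x"
      using Rats_dense_in_real by blast
    then obtain w where "w \<in> centres p q" "w \<in> Z" "cross (q - p) w < cross (q - p) x"
      using R e(1) by (meson less_imp_le order_le_less_trans)
    then show False using x(2)[of w] by simp
  qed
  then have "cross (q - p) x = cross (q - p) (edge_centre p q)" using e(2)[of x] x(1) by auto
  then have "x = edge_centre p q"
    using centres_inj e(1) x(1) assms(1) by (metis IntD1 chord_pairs_iff)
  then show "edge_centre p q \<in> Z" using x(1) by blast
qed

lemma borel_edge_centre_closed:
  assumes "closed Z"
  shows "{pq \<in> chord_pairs C. edge_centre (fst pq) (snd pq) \<in> Z} \<in> sets borel"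
proof -
  define A where "A Y t = {pq. \<exists>x\<in>centres (fst pq) (snd pq).
      (pq, x) \<in> {z. snd z \<in> Y \<and> cross (snd (fst z) - fst (fst z)) (snd z) \<le> t}}"
    for Y :: "(real^2) set" and t
  have "A Y t \<in> sets borel" if "closed Y" for Y t
    unfolding A_def using that
    by (intro borel_closed closed_centre_projection closed_Collect_conj closed_Collect_le
          closed_vimage[unfolded vimage_def] continuous_intros)
  then have "chord_pairs C \<inter> (\<Inter>t\<in>\<rat>. - A UNIV t \<union> A Z t) \<in> sets borel"
    using assms borel_chord_pairs by (intro sets.Int sets.countable_INT'' countable_rat sets.Un) auto
  moreover have "{pq \<in> chord_pairs C. edge_centre (fst pq) (snd pq) \<in> Z}
     = chord_pairs C \<inter> (\<Inter>t\<in>\<rat>. - A UNIV t \<union> A Z t)"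
  proof (intro set_eqI)
    fix pq :: "(real^2) \<times> (real^2)"
    obtain p q where pq: "pq = (p, q)" by fastforce
    have A: "(p, q) \<in> A Y t \<longleftrightarrow> (\<exists>x\<in>centres p q. x \<in> Y \<and> cross (q - p) x \<le> t)" for Y t
      by (simp add: A_def)
    show "pq \<in> {pq \<in> chord_pairs C. edge_centre (fst pq) (snd pq) \<in> Z} \<longleftrightarrow>
        pq \<in> chord_pairs C \<inter> (\<Inter>t\<in>\<rat>. - A UNIV t \<union> A Z t)"
      using edge_centre_in_closed_iff[OF _ assms, of p q] by (auto simp: pq A simp del: bex_simps ball_simps)
  qed
  ultimately show ?thesis by simp
qed

lemma borel_measurable_edge_centre:
  "(\<lambda>pq. if pq \<in> chord_pairs C then edge_centre (fst pq) (snd pq) else 0) \<in> borel_measurable borel"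
  (is "?f \<in> _")
proof (rule borel_measurableI)
  fix U :: "(real^2) set" assume "open U"
  then have Z: "{pq \<in> chord_pairs C. edge_centre (fst pq) (snd pq) \<in> - U} \<in> sets borel"
    by (intro borel_edge_centre_closed) auto
  have "?f -` U \<inter> space borel = (chord_pairs C - {pq \<in> chord_pairs C. edge_centre (fst pq) (snd pq) \<in> - U})
     \<union> (if 0 \<in> U then - chord_pairs C else {})"
    by (auto split: if_splits)
  then show "?f -` U \<inter> space borel \<in> sets borel" using Z borel_chord_pairs by auto
qed

lemma pred_chord_pairs:
  assumes [measurable]: "f \<in> borel_measurable M" "g \<in> borel_measurable M"
  shows "Measurable.pred M (\<lambda>\<omega>. (f \<omega>, g \<omega>) \<in> chord_pairs C)"
  using borel_chord_pairs by measurable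

lemma pred_edge_centre:
  assumes [measurable]: "f \<in> borel_measurable M" "g \<in> borel_measurable M" "h \<in> borel_measurable M"
    and B[measurable]: "B \<in> sets borel"
  shows "Measurable.pred M (\<lambda>\<omega>. (f \<omega>, g \<omega>) \<in> chord_pairs C \<and> h \<omega> - edge_centre (f \<omega>) (g \<omega>) \<in> B)"
proof -
  have [measurable]: "(\<lambda>\<omega>. if (f \<omega>, g \<omega>) \<in> chord_pairs C then edge_centre (f \<omega>) (g \<omega>) else 0) \<in> borel_measurable M"
    using measurable_compose[OF borel_measurable_Pair[OF assms(1,2)] borel_measurable_edge_centre]
    by (simp only: fst_conv snd_conv)
  note pred_chord_pairs[OF assms(1,2), measurable]
  have "Measurable.pred M (\<lambda>\<omega>. (f \<omega>, g \<omega>) \<in> chord_pairs C \<and>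
     h \<omega> - (if (f \<omega>, g \<omega>) \<in> chord_pairs C then edge_centre (f \<omega>) (g \<omega>) else 0) \<in> B)"
    by measurable
  then show ?thesis by (rule measurable_cong[THEN iffD1, rotated]) auto
qed

text \<open>
  The description of \<open>edge_range\<close> through a Borel measurable centre holds on \<open>chord_pairs C\<close>, so
  membership in this set is part of both predicates.
\<close>

lemma pred_edge_range:
  assumes "f \<in> borel_measurable M" "g \<in> borel_measurable M" "h \<in> borel_measurable M"
  shows "Measurable.pred M (\<lambda>\<omega>. (f \<omega>, g \<omega>) \<in> chord_pairs C \<and> h \<omega> \<in> edge_range C (f \<omega>) (g \<omega>))"
    "Measurable.pred M (\<lambda>\<omega>. (f \<omega>, g \<omega>) \<in> chord_pairs C \<and> h \<omega> \<in> frontier (edge_range C (f \<omega>) (g \<omega>)))"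
proof -
  have "C \<in> sets borel" "frontier C \<in> sets borel" using open_range by auto
  note pred_edge_centre[OF assms this(1)] pred_edge_centre[OF assms this(2)]
  then show "Measurable.pred M (\<lambda>\<omega>. (f \<omega>, g \<omega>) \<in> chord_pairs C \<and> h \<omega> \<in> edge_range C (f \<omega>) (g \<omega>))"
    "Measurable.pred M (\<lambda>\<omega>. (f \<omega>, g \<omega>) \<in> chord_pairs C \<and> h \<omega> \<in> frontier (edge_range C (f \<omega>) (g \<omega>)))"
    by (auto simp: edge_range_eq mem_translate frontier_translate cong: conj_cong)
qed

end

section \<open>Concentration of the binomial distribution\<close>

definition binomial_weight :: "nat \<Rightarrow> real \<Rightarrow> nat \<Rightarrow> real" where
  "binomial_weight N p m = real (N choose m) * p ^ m * (1 - p) ^ (N - m)"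

lemma binomial_weight_nonneg: "0 \<le> p \<Longrightarrow> p \<le> 1 \<Longrightarrow> 0 \<le> binomial_weight N p m"
  by (simp add: binomial_weight_def)

lemma sum_binomial_weight: "(\<Sum>m\<le>N. binomial_weight N p m) = 1"
  using binomial_ring[of p "1 - p" N] by (simp add: binomial_weight_def)

lemma sum_binomial_weight_le:
  assumes "0 \<le> p" "p \<le> 1" "finite J"
  shows "(\<Sum>m\<in>J. binomial_weight N p m) \<le> 1"
proof -
  have "(\<Sum>m\<in>J. binomial_weight N p m) = (\<Sum>m\<in>J \<inter> {..N}. binomial_weight N p m)"
    using assms(3) by (intro sum.mono_neutral_right) (auto simp: binomial_weight_def binomial_eq_0)
  also have "\<dots> \<le> (\<Sum>m\<le>N. binomial_weight N p m)"
    using assms by (intro sum_mono2) (auto simp: binomial_weight_nonneg)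
  finally show ?thesis by (simp add: sum_binomial_weight)
qed

lemma binomial_weight_Suc:
  assumes "j < N"
  shows "binomial_weight N p (Suc j) * (real (Suc j) * (1 - p)) = binomial_weight N p j * (real (N - j) * p)"
proof -
  have "real (Suc j) * real (N choose Suc j) = real (N - j) * real (N choose j)"
    using binomial_absorb_comp[of N j] binomial_absorption[of j "N"]
    by (metis of_nat_mult)
  moreover have "(1 - p) ^ (N - j) = (1 - p) * (1 - p) ^ (N - Suc j)"
    using assms by (metis Suc_diff_Suc power_Suc)
  ultimately show ?thesis by (simp add: binomial_weight_def mult_ac)
qed

text \<open>
  If the value \<open>m\<close> does not exceed the mean, the quotient of the weights of \<open>m + s + 1\<close> and \<open>m + s\<close>
  is at least \<open>1 - (2 * s + 1) / d\<close>. Multiplying these quotients loses only \<open>s\<^sup>2 / d\<close> in total. The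
  hypothesis \<open>mode\<close> says that \<open>m \<le> N * p\<close>.
\<close>

lemma binomial_weight_decay:
  assumes d: "0 < d" "d \<le> real m" "d \<le> real (N - m)" and p: "0 \<le> p" "p < 1"
    and mode: "real m * (1 - p) \<le> real (N - m) * p"
    and s: "real (s * s) \<le> d"
  shows "binomial_weight N p m * (1 - real (s * s) / d) \<le> binomial_weight N p (m + s)"
  using s
proof (induction s)
  case 0
  then show ?case by simp
next
  case (Suc s)
  define M where "M = N - m"
  have "m < N" using d(1,3) by (cases "m < N") auto
  have N: "N = m + M" using \<open>m < N\<close> by (simp add: M_def)
  have ss: "real (s * s) + 2 * real s + 1 \<le> d" using Suc.prems by (simp add: algebra_simps)
  have "real s \<le> real s * real s" by (cases s) auto
  then have "real s < real M" using ss d(3) unfolding M_def by linarith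
  then have sM: "s < M" by simp
  define b where "b j = binomial_weight N p (m + j)" for j
  have b0: "0 \<le> b j" for j using p by (simp add: b_def binomial_weight_nonneg)
  have IH: "b 0 * (1 - real (s * s) / d) \<le> b s"
    using Suc.IH ss by (simp add: b_def)
  have "b (Suc s) * (real (m + s + 1) * (1 - p)) = b s * (real (M - s) * p)"
    using binomial_weight_Suc[of "m + s" N p] sM N by (simp add: b_def add_ac)
  then have step: "b (Suc s) * (real (m + s + 1) * (1 - p)) = b s * ((real M - real s) * p)"
    using sM by (simp add: of_nat_diff)
  have mode': "real m * (1 - p) \<le> real M * p" using mode by (simp add: M_def)
  define r where "r = 1 - (2 * real s + 1) / d"
  have "2 * real s + 1 \<le> d" using ss of_nat_0_le_iff[of "s * s", where 'a=real] by linarith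
  then have r0: "0 \<le> r" using d(1) by (simp add: r_def field_simps)
  have rr: "r * (real M * real (m + s + 1)) \<le> (real M - real s) * real m"
  proof -
    have "(real s + 1) * real M * 1 \<le> (real s + 1) * real M * (real (m + s + 1) / d)"
      using d by (intro mult_left_mono) auto
    moreover have "real s * real m * 1 \<le> real s * real (m+s+1) * (real M / d)"
      using d unfolding M_def by (intro mult_mono) auto
    moreover have "(real s + 1) * real M * (real (m + s + 1) / d) + real s * real (m+s+1) * (real M / d)
        = ((2 * real s + 1) / d) * (real M * real (m + s + 1))"
    proof -
      have "(a + 1) * b * (e / d) + a * e * (b / d) = ((2 * a + 1) / d) * (b * e)" for a b e :: real
        using d(1) by (simp add: field_simps)
      then show ?thesis .
    qed
    ultimately show ?thesis by (simp add: r_def algebra_simps)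
  qed
  have Mpos: "real M > 0" using sM by simp
  have ratio: "r * (real (m + s + 1) * (1 - p)) \<le> (real M - real s) * p"
  proof -
    have "real M * (r * (real (m + s + 1) * (1 - p))) = (r * (real M * real (m + s + 1))) * (1 - p)"
      by (simp add: mult_ac)
    also have "\<dots> \<le> ((real M - real s) * real m) * (1 - p)"
      using rr p by (intro mult_right_mono) auto
    also have "\<dots> = (real M - real s) * (real m * (1 - p))" by simp
    also have "\<dots> \<le> (real M - real s) * (real M * p)"
      using mode' sM by (intro mult_left_mono) auto
    finally have "real M * (r * (real (m + s + 1) * (1 - p))) \<le> real M * ((real M - real s) * p)"
      by (simp add: mult_ac)
    then show ?thesis using Mpos by simp
  qed
  have "(b s * r) * (real (m + s + 1) * (1 - p)) \<le> b s * ((real M - real s) * p)"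
    using mult_left_mono[OF ratio b0[of s]] by (simp add: mult_ac)
  also have "\<dots> = b (Suc s) * (real (m + s + 1) * (1 - p))" using step by simp
  finally have "b s * r \<le> b (Suc s)"
    by (rule mult_right_le_imp_le) (use p in auto)
  moreover have "b 0 * (1 - real (Suc s * Suc s) / d) \<le> b 0 * (1 - real (s * s) / d) * r"
  proof -
    have "1 - real (Suc s * Suc s) / d \<le> (1 - real (s * s) / d) * r"
    proof -
      have "(1 - real (s * s) / d) * r = 1 - real (Suc s * Suc s) / d + (real (s * s) / d) * ((2 * real s + 1) / d)"
        using d(1) by (simp add: r_def field_simps)
      then show ?thesis using d(1) by simp
    qed
    then show ?thesis using b0[of 0] by (simp add: mult.assoc mult_left_mono)
  qed
  moreover have "b 0 * (1 - real (s * s) / d) * r \<le> b s * r"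
    using IH r0 by (intro mult_right_mono) auto
  ultimately show ?case by (simp add: b_def)
qed

text \<open>
  At least \<open>sqrt (d / 2)\<close> consecutive values starting at \<open>m\<close> have at least half the weight of \<open>m\<close>, and together
  these weights are at most \<open>1\<close>.
\<close>

lemma binomial_weight_bound_upper:
  assumes d: "0 < d" "d \<le> real m" "d \<le> real (N - m)" and p: "0 \<le> p" "p \<le> 1"
    and mode: "real m * (1 - p) \<le> real (N - m) * p"
  shows "binomial_weight N p m \<le> 2 * sqrt 2 / sqrt d"
proof (cases "p = 1")
  case True
  have "m < N" using d(1,3) by (cases "m < N") auto
  then show ?thesis using True d(1) by (auto simp: binomial_weight_def power_0_left)
next
  case False
  define s0 where "s0 = nat \<lfloor>sqrt (d / 2)\<rfloor>"
  have s0: "real s0 \<le> sqrt (d / 2)" "sqrt (d / 2) \<le> real (Suc s0)"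
    using d(1) unfolding s0_def by (simp, linarith)
  define b where "b = binomial_weight N p m"
  have b0: "0 \<le> b" using p by (simp add: b_def binomial_weight_nonneg)
  have half: "b / 2 \<le> binomial_weight N p (m + s)" if "s \<le> s0" for s
  proof -
    have "real s \<le> sqrt (d / 2)" using that s0(1) by linarith
    then have "(real s)\<^sup>2 \<le> d / 2" using d(1) by (metis of_nat_0_le_iff power_mono real_sqrt_pow2 divide_nonneg_pos less_imp_le zero_less_numeral)
    then have ss: "real (s * s) \<le> d / 2" by (simp add: power2_eq_square)
    then have "b * (1 / 2) \<le> b * (1 - real (s * s) / d)"
      using d(1) b0 by (intro mult_left_mono) (auto simp: field_simps)
    also have "\<dots> \<le> binomial_weight N p (m + s)"
      unfolding b_def using d p False mode ss by (intro binomial_weight_decay) auto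
    finally show ?thesis by simp
  qed
  have "real (Suc s0) * (b / 2) = (\<Sum>s\<le>s0. b / 2)" by simp
  also have "\<dots> \<le> (\<Sum>s\<le>s0. binomial_weight N p (m + s))" using half by (intro sum_mono) auto
  also have "\<dots> = (\<Sum>j\<in>(+) m ` {..s0}. binomial_weight N p j)" by (subst sum.reindex) auto
  also have "\<dots> \<le> 1" using p by (intro sum_binomial_weight_le) auto
  finally have "real (Suc s0) * (b / 2) \<le> 1" .
  moreover have "sqrt (d / 2) * (b / 2) \<le> real (Suc s0) * (b / 2)"
    using s0(2) b0 by (intro mult_right_mono) auto
  ultimately have "sqrt (d / 2) * (b / 2) \<le> 1" by linarith
  then show ?thesis using d(1) by (simp add: b_def real_sqrt_divide field_simps)
qed

text \<open>
  Exchanging success and failure reduces the values above the mean to those below it.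
\<close>

lemma binomial_weight_bound:
  assumes d: "0 < d" "d \<le> real m" "d \<le> real N - real m" and p: "0 \<le> p" "p \<le> 1"
  shows "binomial_weight N p m \<le> 2 * sqrt 2 / sqrt d"
proof -
  have mN: "m \<le> N" using d by linarith
  consider "real m * (1 - p) \<le> real (N - m) * p" | "real (N - m) * p \<le> real m * (1 - p)" by linarith
  then show ?thesis
  proof cases
    case 1
    then show ?thesis using d p mN by (intro binomial_weight_bound_upper) (auto simp: of_nat_diff)
  next
    case 2
    have "binomial_weight N p m = binomial_weight N (1 - p) (N - m)"
      using mN by (simp add: binomial_weight_def binomial_symmetric[of m N])
    also have "\<dots> \<le> 2 * sqrt 2 / sqrt d"
      using 2 d p mN by (intro binomial_weight_bound_upper) (auto simp: of_nat_diff)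
    finally show ?thesis .
  qed
qed

lemma binomial_weight_le_1: "0 \<le> p \<Longrightarrow> p \<le> 1 \<Longrightarrow> binomial_weight N p m \<le> 1"
  using sum_binomial_weight_le[of p "{m}" N] by simp

text \<open>
  The values between \<open>\<lfloor>c * n\<rfloor> - 2\<close> and \<open>\<lfloor>c * n\<rfloor>\<close> are at distance at least \<open>d * n / 2\<close> from both ends of
  \<open>{0..n - 2}\<close> as soon as \<open>d * n > 6\<close>. Otherwise the bound exceeds \<open>1\<close>.
\<close>

lemma binomial_weight_linear_bound:
  fixes c d :: real and n :: nat
  assumes d: "0 < d" "d \<le> c" "d \<le> 1 - c" and n: "1 \<le> n"
    and m: "m \<in> {nat \<lfloor>c * real n\<rfloor> - 2..nat \<lfloor>c * real n\<rfloor>}" and p: "0 \<le> p" "p \<le> 1"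
  shows "binomial_weight (n - 2) p m \<le> 4 / sqrt (d * real n)"
proof (cases "d * real n \<le> 6")
  case True
  have "sqrt (d * real n) \<le> 4" using True by (intro real_le_lsqrt) auto
  then have "1 \<le> 4 / sqrt (d * real n)" using d n by simp
  then show ?thesis using binomial_weight_le_1[OF p] order_trans by blast
next
  case False
  have cn: "d * real n \<le> c * real n" "d * real n \<le> (1 - c) * real n"
    using d by (auto intro!: mult_right_mono)
  have eq: "(1 - c) * real n = real n - c * real n" by (simp add: algebra_simps)
  have n2: "2 \<le> n" using cn eq False by linarith
  have fl: "real (nat \<lfloor>c * real n\<rfloor>) \<le> c * real n" "c * real n - 1 < real (nat \<lfloor>c * real n\<rfloor>)"
    using cn False by linarith+
  have "real m \<ge> c * real n - 3" "real m \<le> c * real n" using m fl by auto linarith+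
  moreover have "real (n - 2) = real n - 2" using n2 by (simp add: of_nat_diff)
  ultimately have "d * real n / 2 \<le> real m" "d * real n / 2 \<le> real (n - 2) - real m"
    using cn eq False by linarith+
  then have "binomial_weight (n - 2) p m \<le> 2 * sqrt 2 / sqrt (d * real n / 2)"
    using d n p by (intro binomial_weight_bound) auto
  also have "\<dots> = 4 / sqrt (d * real n)" by (simp add: real_sqrt_divide)
  finally show ?thesis .
qed

section \<open>Independent samples\<close>

context prob_space
begin

lemma prob_space_PiM_iid: "prob_space (PiM I (\<lambda>_. M))"
  by (intro prob_space_PiM prob_space_axioms)

lemma sets_PiM_section:
  assumes "i \<in> I" "A \<in> sets (PiM I (\<lambda>_. M))" "y \<in> space M"
  shows "{\<tau> \<in> space (PiM (I - {i}) (\<lambda>_. M)). \<tau>(i := y) \<in> A} \<in> sets (PiM (I - {i}) (\<lambda>_. M))"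
proof -
  have "(\<lambda>\<tau>. \<tau>(i := y)) \<in> measurable (PiM (I - {i}) (\<lambda>_. M)) (PiM I (\<lambda>_. M))"
    by (rule measurable_fun_upd[where J="I - {i}"]) (use assms in auto)
  from measurable_sets[OF this assms(2)] show ?thesis
    by (simp add: vimage_def Int_def conj_commute)
qed

text \<open>
  By Fubini's theorem the probability of \<open>A\<close> is the mean over \<open>y\<close> of the probabilities of the
  sections of \<open>A\<close> at \<open>y\<close>.
\<close>

lemma PiM_le_by_conditioning:
  assumes I: "finite I" "i \<in> I" and A: "A \<in> sets (PiM I (\<lambda>_. M))"
    and le: "\<And>y. y \<in> space M \<Longrightarrow>
      emeasure (PiM (I - {i}) (\<lambda>_. M)) {\<tau> \<in> space (PiM (I - {i}) (\<lambda>_. M)). \<tau>(i := y) \<in> A} \<le> b"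
  shows "emeasure (PiM I (\<lambda>_. M)) A \<le> b"
proof -
  interpret P: product_sigma_finite "\<lambda>_. M" by unfold_locales
  have ins: "insert i (I - {i}) = I" using I by auto
  have "emeasure (PiM I (\<lambda>_. M)) A = (\<integral>\<^sup>+ \<omega>. indicator A \<omega> \<partial>PiM (insert i (I - {i})) (\<lambda>_. M))"
    using A ins by simp
  also have "\<dots> = (\<integral>\<^sup>+ y. (\<integral>\<^sup>+ \<tau>. indicator A (\<tau>(i := y)) \<partial>PiM (I - {i}) (\<lambda>_. M)) \<partial>M)"
    using I A ins by (intro P.product_nn_integral_insert_rev) auto
  also have "\<dots> \<le> (\<integral>\<^sup>+ y. b \<partial>M)"
  proof (rule nn_integral_mono)
    fix y assume y: "y \<in> space M"
    have "(\<integral>\<^sup>+ \<tau>. indicator A (\<tau>(i := y)) \<partial>PiM (I - {i}) (\<lambda>_. M))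
       = (\<integral>\<^sup>+ \<tau>. indicator {\<tau> \<in> space (PiM (I - {i}) (\<lambda>_. M)). \<tau>(i := y) \<in> A} \<tau> \<partial>PiM (I - {i}) (\<lambda>_. M))"
      by (intro nn_integral_cong) (auto simp: indicator_def)
    also have "\<dots> \<le> b" using sets_PiM_section[OF I(2) A y] le[OF y] by simp
    finally show "(\<integral>\<^sup>+ \<tau>. indicator A (\<tau>(i := y)) \<partial>PiM (I - {i}) (\<lambda>_. M)) \<le> b" .
  qed
  also have "\<dots> = b" by (simp add: emeasure_space_1)
  finally show ?thesis .
qed

lemma PiM_le_by_conditioning_pair:
  assumes I: "finite I" "i \<in> I" "j \<in> I" "i \<noteq> j" and A: "A \<in> sets (PiM I (\<lambda>_. M))"
    and le: "\<And>y z. y \<in> space M \<Longrightarrow> z \<in> space M \<Longrightarrow> emeasure (PiM (I - {i, j}) (\<lambda>_. M))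
        {\<tau> \<in> space (PiM (I - {i, j}) (\<lambda>_. M)). \<tau>(j := z, i := y) \<in> A} \<le> b"
  shows "emeasure (PiM I (\<lambda>_. M)) A \<le> b"
proof (rule PiM_le_by_conditioning[OF I(1,2) A])
  fix y assume y: "y \<in> space M"
  let ?A = "{\<tau> \<in> space (PiM (I - {i}) (\<lambda>_. M)). \<tau>(i := y) \<in> A}"
  show "emeasure (PiM (I - {i}) (\<lambda>_. M)) ?A \<le> b"
  proof (rule PiM_le_by_conditioning[OF _ _ sets_PiM_section[OF I(2) A y], of j])
    fix z assume z: "z \<in> space M"
    have IJ: "I - {i} - {j} = I - {i, j}" by auto
    have "\<tau>(j := z) \<in> space (PiM (I - {i}) (\<lambda>_. M))" if "\<tau> \<in> space (PiM (I - {i, j}) (\<lambda>_. M))" for \<tau>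
      using that z I by (auto simp: space_PiM PiE_def Pi_def extensional_def)
    then have "{\<tau> \<in> space (PiM (I - {i} - {j}) (\<lambda>_. M)). \<tau>(j := z) \<in> ?A}
       = {\<tau> \<in> space (PiM (I - {i, j}) (\<lambda>_. M)). \<tau>(j := z, i := y) \<in> A}"
      unfolding IJ by auto
    then show "emeasure (PiM (I - {i} - {j}) (\<lambda>_. M))
        {\<tau> \<in> space (PiM (I - {i} - {j}) (\<lambda>_. M)). \<tau>(j := z) \<in> ?A} \<le> b"
      using le[OF y z] unfolding IJ by simp
  qed (use I in auto)
qed

text \<open>
  The event splits into disjoint boxes, one for each set \<open>L\<close> of \<open>m\<close> indices whose coordinates are
  those that lie in \<open>Q\<close>.
\<close>

lemma emeasure_PiM_count:
  assumes J: "finite J" and Q: "Q \<in> events"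
  shows "emeasure (PiM J (\<lambda>_. M)) {\<tau> \<in> space (PiM J (\<lambda>_. M)). card {l\<in>J. \<tau> l \<in> Q} = m}
    = ennreal (binomial_weight (card J) (prob Q) m)"
proof -
  interpret P: finite_product_prob_space "\<lambda>_. M" J by unfold_locales (rule J)
  let ?N = "PiM J (\<lambda>_. M)"
  define box where "box L = Pi\<^sub>E J (\<lambda>l. if l \<in> L then Q else space M - Q)" for L
  have eq: "{\<tau> \<in> space ?N. card {l\<in>J. \<tau> l \<in> Q} = m} = (\<Union>L\<in>{L. L \<subseteq> J \<and> card L = m}. box L)"
  proof (intro equalityI subsetI)
    fix \<tau> assume "\<tau> \<in> {\<tau> \<in> space ?N. card {l\<in>J. \<tau> l \<in> Q} = m}"
    then have "{l\<in>J. \<tau> l \<in> Q} \<in> {L. L \<subseteq> J \<and> card L = m}" "\<tau> \<in> box {l\<in>J. \<tau> l \<in> Q}"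
      by (auto simp: box_def space_PiM PiE_def Pi_def)
    then show "\<tau> \<in> (\<Union>L\<in>{L. L \<subseteq> J \<and> card L = m}. box L)" by blast
  next
    fix \<tau> assume "\<tau> \<in> (\<Union>L\<in>{L. L \<subseteq> J \<and> card L = m}. box L)"
    then obtain L where L: "L \<subseteq> J" "card L = m" "\<tau> \<in> box L" by blast
    have "\<tau> l \<in> Q \<longleftrightarrow> l \<in> L" if "l \<in> J" for l
      using L(3) that by (auto simp: box_def PiE_def Pi_def split: if_splits)
    then have "{l\<in>J. \<tau> l \<in> Q} = L" using L(1) by auto
    moreover have "\<tau> \<in> space ?N" using L(3) sets.sets_into_space[OF Q]
      by (force simp: box_def space_PiM PiE_def Pi_def split: if_splits)
    ultimately show "\<tau> \<in> {\<tau> \<in> space ?N. card {l\<in>J. \<tau> l \<in> Q} = m}" using L(2) by simp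
  qed
  have box: "box L \<in> sets ?N" for L
    unfolding box_def using J Q by (intro sets_PiM_I_finite) auto
  have fin: "finite {L. L \<subseteq> J \<and> card L = m}" using J by simp
  have disj: "disjoint_family_on box {L. L \<subseteq> J \<and> card L = m}"
    unfolding disjoint_family_on_def
  proof (intro ballI impI)
    fix L L' assume L: "L \<in> {L. L \<subseteq> J \<and> card L = m}" "L' \<in> {L. L \<subseteq> J \<and> card L = m}" "L \<noteq> L'"
    then obtain l where l: "l \<in> J" "l \<in> L \<longleftrightarrow> l \<notin> L'" by blast
    then show "box L \<inter> box L' = {}"
      by (auto simp: box_def PiE_def Pi_def split: if_splits)
  qed
  have meas: "emeasure ?N (box L) = ennreal (prob Q ^ m * (1 - prob Q) ^ (card J - m))"
    if L: "L \<subseteq> J" "card L = m" for L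
  proof -
    have "emeasure ?N (box L) = ennreal (\<Prod>l\<in>J. prob (if l \<in> L then Q else space M - Q))"
      unfolding box_def using Q by (subst P.emeasure_eq_measure, subst P.prob_times) auto
    also have "(\<Prod>l\<in>J. prob (if l \<in> L then Q else space M - Q)) = (\<Prod>l\<in>J. if l \<in> L then prob Q else 1 - prob Q)"
      using Q by (intro prod.cong) (auto simp: prob_compl)
    also have "\<dots> = prob Q ^ card (J \<inter> L) * (1 - prob Q) ^ card (J - L)"
      using J by (simp add: prod.If_cases Diff_eq)
    also have "J \<inter> L = L" using L by auto
    also have "card (J - L) = card J - m" using L J by (simp add: card_Diff_subset finite_subset)
    finally show ?thesis using L(2) by simp
  qed
  have "emeasure ?N (\<Union>L\<in>{L. L \<subseteq> J \<and> card L = m}. box L) = (\<Sum>L\<in>{L. L \<subseteq> J \<and> card L = m}. emeasure ?N (box L))"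
    using box disj fin by (intro sum_emeasure[symmetric]) auto
  also have "\<dots> = (\<Sum>L\<in>{L. L \<subseteq> J \<and> card L = m}. ennreal (prob Q ^ m * (1 - prob Q) ^ (card J - m)))"
    using meas by (intro sum.cong) auto
  also have "\<dots> = ennreal (binomial_weight (card J) (prob Q) m)"
    using J by (simp add: n_subsets binomial_weight_def ennreal_of_nat_eq_real_of_nat mult.assoc flip: ennreal_mult)
  finally show ?thesis unfolding eq .
qed

end

section \<open>Counting measurably\<close>

text \<open>
  Sample points may coincide on a null set, but the integrands have to be measurable on the whole
  sample space. Counting first occurrences counts distinct points through measurable conditions.
\<close>

definition first_occurrences :: "(nat \<Rightarrow> 'a) \<Rightarrow> nat set \<Rightarrow> nat set" where
  "first_occurrences \<omega> L = {l\<in>L. \<forall>l'\<in>L. l' < l \<longrightarrow> \<omega> l' \<noteq> \<omega> l}"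

lemma bij_betw_first_occurrences: "bij_betw \<omega> (first_occurrences \<omega> L) (\<omega> ` L)"
  unfolding bij_betw_def
proof
  show "inj_on \<omega> (first_occurrences \<omega> L)"
    unfolding first_occurrences_def inj_on_def by (auto, metis linorder_neqE_nat)
  show "\<omega> ` first_occurrences \<omega> L = \<omega> ` L"
  proof (intro equalityI subsetI)
    fix y assume "y \<in> \<omega> ` L"
    then have ex: "\<exists>l. l \<in> L \<and> \<omega> l = y" by blast
    define l where "l = (LEAST l. l \<in> L \<and> \<omega> l = y)"
    have "l \<in> L \<and> \<omega> l = y" unfolding l_def by (rule LeastI_ex[OF ex])
    moreover have "\<omega> l' \<noteq> y" if "l' \<in> L" "l' < l" for l'
      using that not_less_Least unfolding l_def by blast
    ultimately show "y \<in> \<omega> ` first_occurrences \<omega> L" unfolding first_occurrences_def by auto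
  qed (auto simp: first_occurrences_def)
qed

lemma card_image_first_occurrences: "card (\<omega> ` L) = card (first_occurrences \<omega> L)"
  using bij_betw_same_card[OF bij_betw_first_occurrences] by metis

lemma sets_card_eq:
  fixes S :: "'a \<Rightarrow> nat set"
  assumes "\<And>l. {x \<in> space M. l \<in> S x} \<in> sets M"
  shows "{x \<in> space M. card (S x) = m} \<in> sets M"
proof -
  have "(\<lambda>x. card (S x)) \<in> measurable M (count_space UNIV)"
    using assms by (rule measurable_card)
  from measurable_sets[OF this, of "{m}"] show ?thesis
    by (simp add: vimage_def Int_def conj_commute)
qed

lemma borel_measurable_card_finite:
  assumes "finite J" "\<And>x. E x \<subseteq> J" "\<And>j. j \<in> J \<Longrightarrow> {x \<in> space M. j \<in> E x} \<in> sets M"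
  shows "(\<lambda>x. real (card (E x))) \<in> borel_measurable M"
proof -
  have "real (card (E x)) = (\<Sum>j\<in>J. indicator {x \<in> space M. j \<in> E x} x)" if "x \<in> space M" for x
  proof -
    have "(\<Sum>j\<in>J. indicator {x \<in> space M. j \<in> E x} x :: real) = (\<Sum>j\<in>J. if j \<in> E x then 1 else 0)"
      using that by (intro sum.cong) (auto simp: indicator_def)
    also have "\<dots> = real (card (J \<inter> E x))" using assms(1) by (simp add: sum.If_cases)
    also have "J \<inter> E x = E x" using assms(2) by blast
    finally show ?thesis by simp
  qed
  moreover have "(\<lambda>x. \<Sum>j\<in>J. indicator {x \<in> space M. j \<in> E x} x :: real) \<in> borel_measurable M"
    using assms(3) by (intro borel_measurable_sum borel_measurable_indicator)
  ultimately show ?thesis by (simp cong: measurable_cong)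
qed

section \<open>Samples avoiding boundaries of translates\<close>

locale iid_sample = strictly_convex_range C + prob_space P
  for C :: "(real^2) set" and P :: "(real^2) measure" +
  assumes sets_P [measurable_cong]: "sets P = sets borel"
    and null_frontier: "measure P (frontier ((+) x ` C)) = 0"
begin

abbreviation sample :: "nat set \<Rightarrow> (nat \<Rightarrow> real^2) measure" where
  "sample I \<equiv> PiM I (\<lambda>_. P)"

lemma measurable_point: "i \<in> I \<Longrightarrow> (\<lambda>\<omega>. \<omega> i) \<in> borel_measurable (sample I)"
  using measurable_component_singleton[of i I "\<lambda>_. P"] measurable_cong_sets[OF refl sets_P] by simp

lemma sets_point:
  assumes "i \<in> I" "B \<in> sets borel"
  shows "{\<omega> \<in> space (sample I). \<omega> i \<in> B} \<in> sets (sample I)"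
  using measurable_sets[OF measurable_point[OF assms(1)] assms(2)]
  by (simp add: vimage_def Int_def conj_commute)

lemma sets_point_eq:
  assumes "i \<in> I" "l \<in> I"
  shows "{\<omega> \<in> space (sample I). \<omega> i = \<omega> l} \<in> sets (sample I)"
proof -
  note measurable_point[OF assms(1), measurable] measurable_point[OF assms(2), measurable]
  show ?thesis by measurable
qed

lemma emeasure_sample_single:
  assumes "l \<in> J" "Z \<in> sets borel" "measure P Z = 0"
  shows "emeasure (sample J) {\<tau> \<in> space (sample J). \<tau> l \<in> Z} = 0"
proof -
  interpret pp: product_prob_space "\<lambda>_. P" J by unfold_locales
  show ?thesis using pp.emeasure_PiM_Collect_single[of l Z] assms
    by (simp add: sets_P emeasure_eq_measure)
qed

text \<open>
  A point lies on the boundary of a suitable translate of \<open>C\<close>.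
\<close>

lemma null_point: "measure P {y} = 0"
proof -
  obtain a where a: "a \<in> frontier C"
    using nonempty open_range compact_closure
    by (metis compact_imp_bounded frontier_eq_empty frontier_not_empty not_bounded_UNIV bounded_subset closure_subset all_not_in_conv)
  have "measure P {y} \<le> measure P (frontier ((+) (y - a) ` C))"
    using a by (intro finite_measure_mono) (auto simp: frontier_translate sets_P)
  then show ?thesis using null_frontier by (simp add: measure_le_0_iff)
qed

lemma AE_distinct:
  assumes "finite I"
  shows "AE \<omega> in sample I. inj_on \<omega> I"
proof -
  have "AE \<omega> in sample I. \<omega> i \<noteq> \<omega> l" if il: "i \<in> I" "l \<in> I" "i \<noteq> l" for i l
  proof (rule AE_I)
    show A: "{\<omega> \<in> space (sample I). \<omega> i = \<omega> l} \<in> sets (sample I)"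
      using il by (intro sets_point_eq)
    have "emeasure (sample I) {\<omega> \<in> space (sample I). \<omega> i = \<omega> l} \<le> 0"
    proof (rule PiM_le_by_conditioning[OF assms il(1) A])
      fix y
      have "emeasure (sample (I - {i})) {\<tau> \<in> space (sample (I - {i})). \<tau>(i := y) \<in> {\<omega> \<in> space (sample I). \<omega> i = \<omega> l}}
         \<le> emeasure (sample (I - {i})) {\<tau> \<in> space (sample (I - {i})). \<tau> l \<in> {y}}"
        using il by (intro emeasure_mono sets_point) auto
      also have "\<dots> = 0" using il assms by (intro emeasure_sample_single null_point) auto
      finally show "emeasure (sample (I - {i})) {\<tau> \<in> space (sample (I - {i})).
          \<tau>(i := y) \<in> {\<omega> \<in> space (sample I). \<omega> i = \<omega> l}} \<le> 0" .
    qed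
    then show "emeasure (sample I) {\<omega> \<in> space (sample I). \<omega> i = \<omega> l} = 0" by simp
  qed auto
  then have "AE \<omega> in sample I. \<forall>i\<in>I. \<forall>l\<in>I. i \<noteq> l \<longrightarrow> \<omega> i \<noteq> \<omega> l"
    using assms by (intro AE_finite_allI) (auto intro: AE_I2)
  then show ?thesis by eventually_elim (auto simp: inj_on_def)
qed

definition on_edge_frontier :: "nat set \<Rightarrow> nat \<Rightarrow> nat \<Rightarrow> nat \<Rightarrow> (nat \<Rightarrow> real^2) set" where
  "on_edge_frontier I i j l = {\<omega> \<in> space (sample I).
     (\<omega> i, \<omega> j) \<in> chord_pairs C \<and> \<omega> l \<in> frontier (edge_range C (\<omega> i) (\<omega> j))}"

text \<open>
  Given the points with indices \<open>i\<close> and \<open>j\<close>, the point with index \<open>l\<close> has to lie on the boundary of one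
  fixed translate, which is a null set.
\<close>

lemma AE_off_edge_frontier:
  assumes "finite I" and ijl: "i \<in> I" "j \<in> I" "l \<in> I" "i \<noteq> j" "i \<noteq> l" "j \<noteq> l"
  shows "AE \<omega> in sample I. \<omega> \<notin> on_edge_frontier I i j l"
proof (rule AE_I)
  show A: "on_edge_frontier I i j l \<in> sets (sample I)"
    unfolding on_edge_frontier_def
    using pred_edge_range(2)[OF ijl(1-3)[THEN measurable_point]] by simp
  have "emeasure (sample I) (on_edge_frontier I i j l) \<le> 0"
  proof (rule PiM_le_by_conditioning_pair[OF assms(1) ijl(1,2,4) A])
    fix y z
    let ?J = "I - {i, j}"
    show "emeasure (sample ?J) {\<tau> \<in> space (sample ?J). \<tau>(j := z, i := y) \<in> on_edge_frontier I i j l} \<le> 0"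
    proof (cases "(y, z) \<in> chord_pairs C")
      case True
      have "emeasure (sample ?J) {\<tau> \<in> space (sample ?J). \<tau>(j := z, i := y) \<in> on_edge_frontier I i j l}
        \<le> emeasure (sample ?J) {\<tau> \<in> space (sample ?J). \<tau> l \<in> frontier ((+) (edge_centre y z) ` C)}"
        using ijl edge_range_eq[OF True]
        by (intro emeasure_mono sets_point) (auto simp: on_edge_frontier_def)
      also have "\<dots> = 0" using ijl assms(1) by (intro emeasure_sample_single null_frontier) auto
      finally show ?thesis .
    next
      case False
      then have "{\<tau> \<in> space (sample ?J). \<tau>(j := z, i := y) \<in> on_edge_frontier I i j l} = {}"
        using ijl by (auto simp: on_edge_frontier_def)
      then show ?thesis by (simp only: emeasure_empty order_refl)
    qed
  qed
  then show "emeasure (sample I) (on_edge_frontier I i j l) = 0" by simp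
qed auto

lemma AE_general_position:
  assumes "finite I"
  shows "AE \<omega> in sample I. general_position (\<omega> ` I)"
proof -
  have "AE \<omega> in sample I. \<forall>i\<in>I. \<forall>j\<in>I. \<forall>l\<in>I.
      i \<noteq> j \<and> i \<noteq> l \<and> j \<noteq> l \<longrightarrow> \<omega> \<notin> on_edge_frontier I i j l"
    using assms AE_off_edge_frontier[OF assms] by (intro AE_finite_allI) (auto intro: AE_I2)
  then show ?thesis
    using AE_space
  proof eventually_elim
    fix \<omega> assume \<omega>: "\<forall>i\<in>I. \<forall>j\<in>I. \<forall>l\<in>I.
      i \<noteq> j \<and> i \<noteq> l \<and> j \<noteq> l \<longrightarrow> \<omega> \<notin> on_edge_frontier I i j l" "\<omega> \<in> space (sample I)"
    show "general_position (\<omega> ` I)"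
      unfolding general_position_def
    proof (safe; rule ccontr)
      fix Q i j l assume Q: "Q \<in> translates C" and I: "i \<in> I" "j \<in> I" "l \<in> I"
        and fr: "{\<omega> i, \<omega> j, \<omega> l} \<subseteq> frontier Q"
        and ne: "\<omega> i \<noteq> \<omega> l" "\<omega> j \<noteq> \<omega> l" "\<omega> i \<noteq> \<omega> j"
      have "Q \<in> ranges_through C (\<omega> i) (\<omega> j)" using Q fr by (auto simp: ranges_through_def)
      note c = ranges_through_cases[OF ne(3) this]
      have "\<omega> \<in> on_edge_frontier I i j l \<or> \<omega> \<in> on_edge_frontier I j i l"
        using c fr \<omega>(2) by (auto simp: on_edge_frontier_def)
      moreover have "i \<noteq> j \<and> i \<noteq> l \<and> j \<noteq> l" using ne by auto
      ultimately show False using \<omega>(1) I by metis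
    qed
  qed
qed

section \<open>Measurability of the two counts\<close>

lemma sets_first_occurrence:
  assumes "finite L" "L \<subseteq> I"
  shows "{\<omega> \<in> space (sample I). l \<in> first_occurrences \<omega> L} \<in> sets (sample I)"
proof (cases "l \<in> L")
  case True
  have "{\<omega> \<in> space (sample I). \<forall>l'\<in>{l'\<in>L. l' < l}. \<not> \<omega> l' = \<omega> l} \<in> sets (sample I)"
    using assms True by (intro sets.sets_Collect_finite_All sets.sets_Collect_neg sets_point_eq) auto
  also have "{\<omega> \<in> space (sample I). \<forall>l'\<in>{l'\<in>L. l' < l}. \<not> \<omega> l' = \<omega> l} =
      {\<omega> \<in> space (sample I). l \<in> first_occurrences \<omega> L}"
    using True by (auto simp: first_occurrences_def)
  finally show ?thesis .
next
  case False
  then have "{\<omega> \<in> space (sample I). l \<in> first_occurrences \<omega> L} = {}"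
    by (auto simp: first_occurrences_def)
  then show ?thesis by (simp only: sets.empty_sets)
qed

text \<open>
  Edges correspond to pairs of first occurrences, and the points in the range of an edge to first
  occurrences as well.
\<close>

lemma borel_measurable_card_k_edges:
  assumes I: "finite I"
  shows "(\<lambda>\<omega>. real (card (k_edges C m (\<omega> ` I)))) \<in> borel_measurable (sample I)"
proof -
  define L where "L \<omega> i j = {l. l \<in> first_occurrences \<omega> I \<and>
      ((\<omega> i, \<omega> j) \<in> chord_pairs C \<and> \<omega> l \<in> edge_range C (\<omega> i) (\<omega> j))}" for \<omega> i j
  define E where "E \<omega> = {(i, j). i \<in> first_occurrences \<omega> I \<and> j \<in> first_occurrences \<omega> I \<and>
      (\<omega> i, \<omega> j) \<in> chord_pairs C \<and> card (L \<omega> i j) = m}" for \<omega>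
  have card: "card (k_edges C m (\<omega> ` I)) = card (E \<omega>)" for \<omega>
  proof -
    note bij = bij_betw_first_occurrences[of \<omega> I]
    have inj: "inj_on \<omega> (first_occurrences \<omega> I)" and im: "\<omega> ` first_occurrences \<omega> I = \<omega> ` I"
      using bij by (auto simp: bij_betw_def)
    have cL: "card (\<omega> ` I \<inter> edge_range C (\<omega> i) (\<omega> j)) = card (L \<omega> i j)"
      if "(\<omega> i, \<omega> j) \<in> chord_pairs C" for i j
    proof -
      have "\<omega> ` I \<inter> edge_range C (\<omega> i) (\<omega> j) = \<omega> ` L \<omega> i j"
        unfolding im[symmetric] L_def using that by blast
      moreover have "inj_on \<omega> (L \<omega> i j)" using inj by (rule inj_on_subset) (auto simp: L_def)
      ultimately show ?thesis by (simp add: card_image)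
    qed
    have "k_edges C m (\<omega> ` I) = map_prod \<omega> \<omega> ` E \<omega>"
    proof (intro equalityI subsetI)
      fix e assume e: "e \<in> k_edges C m (\<omega> ` I)"
      then obtain i j where "i \<in> first_occurrences \<omega> I" "j \<in> first_occurrences \<omega> I" "e = (\<omega> i, \<omega> j)"
        unfolding k_edges_def im[symmetric] by blast
      moreover from this e have "(\<omega> i, \<omega> j) \<in> k_edges C m (\<omega> ` I)" by simp
      then have "(\<omega> i, \<omega> j) \<in> chord_pairs C" "card (\<omega> ` I \<inter> edge_range C (\<omega> i) (\<omega> j)) = m"
        by (simp_all add: k_edges_def)
      ultimately show "e \<in> map_prod \<omega> \<omega> ` E \<omega>" using cL
        by (intro image_eqI[of _ _ "(i, j)"]) (auto simp: E_def)
    next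
      fix e assume "e \<in> map_prod \<omega> \<omega> ` E \<omega>"
      then show "e \<in> k_edges C m (\<omega> ` I)" using cL
        by (auto simp: E_def k_edges_def first_occurrences_def)
    qed
    moreover have "inj_on (map_prod \<omega> \<omega>) (E \<omega>)"
      using inj by (auto simp: inj_on_def E_def)
    ultimately show ?thesis by (simp add: card_image)
  qed
  have meas: "{\<omega> \<in> space (sample I). ij \<in> E \<omega>} \<in> sets (sample I)" if IJ: "ij \<in> I \<times> I" for ij
  proof -
    obtain i j where ij: "ij = (i, j)" "i \<in> I" "j \<in> I" using IJ by blast
    have "{\<omega> \<in> space (sample I). l \<in> L \<omega> i j} \<in> sets (sample I)" for l
    proof (cases "l \<in> I")
      case True
      have "Measurable.pred (sample I)
        (\<lambda>\<omega>. (\<omega> i, \<omega> j) \<in> chord_pairs C \<and> \<omega> l \<in> edge_range C (\<omega> i) (\<omega> j))"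
        using ij True by (intro pred_edge_range measurable_point) auto
      from predE[OF this] sets_first_occurrence[OF I order_refl, of l]
      show ?thesis unfolding L_def mem_Collect_eq by (rule sets.sets_Collect_conj)
    next
      case False
      then have "{\<omega> \<in> space (sample I). l \<in> L \<omega> i j} = {}"
        by (auto simp: L_def first_occurrences_def)
      then show ?thesis by (simp only: sets.empty_sets)
    qed
    then have "{\<omega> \<in> space (sample I). card (L \<omega> i j) = m} \<in> sets (sample I)"
      by (rule sets_card_eq)
    moreover have "{\<omega> \<in> space (sample I). (\<omega> i, \<omega> j) \<in> chord_pairs C} \<in> sets (sample I)"
      using ij by (intro predE pred_chord_pairs measurable_point)
    ultimately show ?thesis
      unfolding E_def ij(1) mem_Collect_eq case_prod_conv
      using sets_first_occurrence[OF I order_refl] by (intro sets.sets_Collect_conj)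
  qed
  have sub: "E \<omega> \<subseteq> I \<times> I" for \<omega> by (auto simp: E_def first_occurrences_def)
  show ?thesis unfolding card
    by (rule borel_measurable_card_finite[OF _ sub meas]) (simp add: I)
qed

text \<open>
  A set is recorded by the indices of its points. That some translate cuts it off means that a cell
  is nonempty. Cells are open, so it suffices to look for centres in a countable dense set.
\<close>

lemma borel_measurable_card_k_sets:
  assumes I: "finite I"
  shows "(\<lambda>\<omega>. real (card (k_sets C k (\<omega> ` I)))) \<in> borel_measurable (sample I)"
proof -
  define E where "E \<omega> = {L. L \<subseteq> I \<and> card (first_occurrences \<omega> L) = k \<and>
      cell (\<omega> ` L) (\<omega> ` (I - L)) \<noteq> {}}" for \<omega>
  have card: "card (k_sets C k (\<omega> ` I)) = card (E \<omega>)" for \<omega>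
  proof -
    \<comment> \<open>A cell can be nonempty only if coinciding points are all in or all out. Therefore
        an index set is determined by the set of its points.\<close>
    have sep: "\<omega> l \<notin> \<omega> ` L" if L: "L \<in> E \<omega>" "l \<in> I - L" for L l
    proof
      assume "\<omega> l \<in> \<omega> ` L"
      then obtain l' where l': "l' \<in> L" "\<omega> l = \<omega> l'" by blast
      obtain x where "x \<in> cell (\<omega> ` L) (\<omega> ` (I - L))" using L(1) by (auto simp: E_def)
      then have "\<omega> l' - x \<in> C" "\<omega> l - x \<notin> closure C"
        using l'(1) L(2) unfolding cell_def by blast+
      then show False using l'(2) closure_subset[of C] by auto
    qed
    have "k_sets C k (\<omega> ` I) = (\<lambda>L. \<omega> ` L) ` E \<omega>"
    proof (intro equalityI subsetI)
      fix T assume "T \<in> k_sets C k (\<omega> ` I)"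
      then have T: "T \<subseteq> \<omega> ` I" "card T = k" "cell T (\<omega> ` I - T) \<noteq> {}"
        using k_sets_iff[of "\<omega> ` I"] I by auto
      define L where "L = {l\<in>I. \<omega> l \<in> T}"
      have "\<omega> ` L = T" "\<omega> ` (I - L) = \<omega> ` I - T" using T(1) by (auto simp: L_def)
      then have "L \<in> E \<omega>" using T by (auto simp: E_def L_def card_image_first_occurrences[symmetric])
      then show "T \<in> (\<lambda>L. \<omega> ` L) ` E \<omega>" using \<open>\<omega> ` L = T\<close> by blast
    next
      fix T assume "T \<in> (\<lambda>L. \<omega> ` L) ` E \<omega>"
      then obtain L where L: "L \<in> E \<omega>" "T = \<omega> ` L" by blast
      have "\<omega> ` (I - L) = \<omega> ` I - T" using sep[OF L(1)] L by (auto simp: E_def)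
      then show "T \<in> k_sets C k (\<omega> ` I)"
        using L k_sets_iff[of "\<omega> ` I"] I by (auto simp: E_def card_image_first_occurrences[symmetric])
    qed
    moreover have "inj_on (\<lambda>L. \<omega> ` L) (E \<omega>)"
    proof (rule inj_onI)
      fix L L' assume L: "L \<in> E \<omega>" "L' \<in> E \<omega>" "\<omega> ` L = \<omega> ` L'"
      then have sub: "L \<subseteq> I" "L' \<subseteq> I" by (auto simp: E_def)
      show "L = L'" using sep[OF L(1)] sep[OF L(2)] sub L(3) by blast
    qed
    ultimately show ?thesis by (simp add: card_image)
  qed
  obtain D :: "(real^2) set" where D: "countable D" "\<And>U. open U \<Longrightarrow> U \<noteq> {} \<Longrightarrow> \<exists>d\<in>D. d \<in> U"
    using countable_dense_setE by metis
  have meas: "{\<omega> \<in> space (sample I). L \<in> E \<omega>} \<in> sets (sample I)" if L: "L \<in> Pow I" for L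
  proof -
    have fin: "finite L" using L I finite_subset by auto
    have "open (cell (\<omega> ` L) (\<omega> ` (I - L)))" for \<omega>
      using fin I by (intro open_cell) auto
    then have ex: "cell (\<omega> ` L) (\<omega> ` (I - L)) \<noteq> {} \<longleftrightarrow>
        (\<exists>d\<in>D. (\<forall>l\<in>L. \<omega> l - d \<in> C) \<and> (\<forall>l\<in>I - L. \<not> \<omega> l - d \<in> closure C))" for \<omega>
      using D(2)[of "cell (\<omega> ` L) (\<omega> ` (I - L))"] by (auto simp: cell_def)
    have shift: "{\<omega> \<in> space (sample I). \<omega> l - d \<in> B} \<in> sets (sample I)"
      if "l \<in> I" "B \<in> sets borel" for l d and B :: "(real^2) set"
    proof -
      note measurable_point[OF that(1), measurable] that(2)[measurable]
      show ?thesis by measurable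
    qed
    have "{\<omega> \<in> space (sample I).
        \<exists>d\<in>D. (\<forall>l\<in>L. \<omega> l - d \<in> C) \<and> (\<forall>l\<in>I - L. \<not> \<omega> l - d \<in> closure C)} \<in> sets (sample I)"
      using D(1) fin I L open_range
      by (intro sets.sets_Collect_countable_Ex' sets.sets_Collect_conj sets.sets_Collect_finite_All
          sets.sets_Collect_neg shift) auto
    moreover have "{\<omega> \<in> space (sample I). card (first_occurrences \<omega> L) = k} \<in> sets (sample I)"
      using L fin by (intro sets_card_eq sets_first_occurrence) auto
    ultimately have "{\<omega> \<in> space (sample I). card (first_occurrences \<omega> L) = k \<and>
        (\<exists>d\<in>D. (\<forall>l\<in>L. \<omega> l - d \<in> C) \<and> (\<forall>l\<in>I - L. \<not> \<omega> l - d \<in> closure C))} \<in> sets (sample I)"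
      by (intro sets.sets_Collect_conj)
    moreover have "L \<in> E \<omega> \<longleftrightarrow> card (first_occurrences \<omega> L) = k \<and>
        (\<exists>d\<in>D. (\<forall>l\<in>L. \<omega> l - d \<in> C) \<and> (\<forall>l\<in>I - L. \<not> \<omega> l - d \<in> closure C))" for \<omega>
      using L unfolding E_def mem_Collect_eq ex Pow_iff by blast
    ultimately show ?thesis by (simp only:)
  qed
  have sub: "E \<omega> \<subseteq> Pow I" for \<omega> by (auto simp: E_def)
  show ?thesis unfolding card
    by (rule borel_measurable_card_finite[OF _ sub meas]) (simp add: I)
qed

section \<open>Expected numbers of edges and sets\<close>

text \<open>
  The endpoints are removed from the count, so that given the endpoints the count is binomially
  distributed with parameter \<open>card I - 2\<close>.
\<close>

definition edge_event :: "nat set \<Rightarrow> nat \<Rightarrow> nat \<times> nat \<Rightarrow> (nat \<Rightarrow> real^2) set" where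
  "edge_event I m ij = {\<omega> \<in> space (sample I). (\<omega> (fst ij), \<omega> (snd ij)) \<in> chord_pairs C \<and>
     card {l\<in>I - {fst ij, snd ij}. \<omega> l \<in> edge_range C (\<omega> (fst ij)) (\<omega> (snd ij))} = m}"

lemma sets_edge_event:
  assumes "i \<in> I" "j \<in> I"
  shows "edge_event I m (i, j) \<in> sets (sample I)"
proof -
  define L where "L \<omega> = {l\<in>I - {i, j}. (\<omega> i, \<omega> j) \<in> chord_pairs C \<and> \<omega> l \<in> edge_range C (\<omega> i) (\<omega> j)}" for \<omega>
  have "{\<omega> \<in> space (sample I). l \<in> L \<omega>} \<in> sets (sample I)" for l
  proof (cases "l \<in> I - {i, j}")
    case True
    then have "Measurable.pred (sample I)
        (\<lambda>\<omega>. (\<omega> i, \<omega> j) \<in> chord_pairs C \<and> \<omega> l \<in> edge_range C (\<omega> i) (\<omega> j))"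
      using assms by (intro pred_edge_range measurable_point) auto
    from predE[OF this] True show ?thesis unfolding L_def by simp
  next
    case False
    then have "{\<omega> \<in> space (sample I). l \<in> L \<omega>} = {}" unfolding L_def by blast
    then show ?thesis by (simp only: sets.empty_sets)
  qed
  then have L: "{\<omega> \<in> space (sample I). card (L \<omega>) = m} \<in> sets (sample I)"
    by (rule sets_card_eq)
  have "{\<omega> \<in> space (sample I). (\<omega> i, \<omega> j) \<in> chord_pairs C \<and> card (L \<omega>) = m} \<in> sets (sample I)"
    using predE[OF pred_chord_pairs[OF assms[THEN measurable_point]]] L by (intro sets.sets_Collect_conj)
  also have "{\<omega> \<in> space (sample I). (\<omega> i, \<omega> j) \<in> chord_pairs C \<and> card (L \<omega>) = m} = edge_event I m (i, j)"
    by (auto simp: edge_event_def L_def cong: conj_cong)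
  finally show ?thesis .
qed

lemma emeasure_edge_event:
  assumes I: "finite I" "i \<in> I" "j \<in> I" "i \<noteq> j"
    and b: "\<And>p. 0 \<le> p \<Longrightarrow> p \<le> 1 \<Longrightarrow> binomial_weight (card I - 2) p m \<le> b"
  shows "emeasure (sample I) (edge_event I m (i, j)) \<le> ennreal b"
proof (rule PiM_le_by_conditioning_pair[OF I sets_edge_event[OF I(2,3)]])
  fix y z
  let ?J = "I - {i, j}"
  have card: "card ?J = card I - 2" using I by (simp add: card_Diff_subset)
  show "emeasure (sample ?J) {\<tau> \<in> space (sample ?J). \<tau>(j := z, i := y) \<in> edge_event I m (i, j)} \<le> ennreal b"
  proof (cases "(y, z) \<in> chord_pairs C")
    case True
    have Q: "edge_range C y z \<in> events"
      using open_range by (simp add: edge_range_eq[OF True] sets_P open_translation)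
    have eq: "{l \<in> ?J. (\<tau>(j := z, i := y)) l \<in> edge_range C y z} = {l \<in> ?J. \<tau> l \<in> edge_range C y z}" for \<tau>
      by auto
    have "emeasure (sample ?J) {\<tau> \<in> space (sample ?J). \<tau>(j := z, i := y) \<in> edge_event I m (i, j)}
      \<le> emeasure (sample ?J) {\<tau> \<in> space (sample ?J). card {l\<in>?J. \<tau> l \<in> edge_range C y z} = m}"
    proof (rule emeasure_mono)
      show "{\<tau> \<in> space (sample ?J). \<tau>(j := z, i := y) \<in> edge_event I m (i, j)}
         \<subseteq> {\<tau> \<in> space (sample ?J). card {l\<in>?J. \<tau> l \<in> edge_range C y z} = m}"
        using I(4) unfolding edge_event_def by (auto simp: eq[simplified])
      have "{\<tau> \<in> space (sample ?J). l \<in> {l\<in>?J. \<tau> l \<in> edge_range C y z}} \<in> sets (sample ?J)" for l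
      proof (cases "l \<in> ?J")
        case True
        then have "{\<tau> \<in> space (sample ?J). l \<in> {l\<in>?J. \<tau> l \<in> edge_range C y z}}
            = {\<tau> \<in> space (sample ?J). \<tau> l \<in> edge_range C y z}" by blast
        then show ?thesis using sets_point[OF True Q[unfolded sets_P]] by (simp only:)
      next
        case False
        then have "{\<tau> \<in> space (sample ?J). l \<in> {l\<in>?J. \<tau> l \<in> edge_range C y z}} = {}" by blast
        then show ?thesis by (simp only: sets.empty_sets)
      qed
      then show "{\<tau> \<in> space (sample ?J). card {l\<in>?J. \<tau> l \<in> edge_range C y z} = m} \<in> sets (sample ?J)"
        by (rule sets_card_eq)
    qed
    also have "\<dots> = ennreal (binomial_weight (card ?J) (prob (edge_range C y z)) m)"
      using I(1) Q by (intro emeasure_PiM_count) auto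
    also have "\<dots> \<le> ennreal b" unfolding card by (intro ennreal_leI b) auto
    finally show ?thesis .
  next
    case False
    then have "{\<tau> \<in> space (sample ?J). \<tau>(j := z, i := y) \<in> edge_event I m (i, j)} = {}"
      using I by (auto simp: edge_event_def)
    then show ?thesis by (simp only: emeasure_empty zero_le)
  qed
qed

text \<open>
  Ranges are open, so the endpoints of an edge do not count towards the points in its range.
\<close>

lemma card_k_edges_le_events:
  assumes I: "finite I" and inj: "inj_on \<omega> I" and sp: "\<omega> \<in> space (sample I)"
  shows "real (card (k_edges C m (\<omega> ` I)))
    \<le> (\<Sum>ij\<in>{ij\<in>I \<times> I. fst ij \<noteq> snd ij}. indicator (edge_event I m ij) \<omega>)"
proof -
  let ?J = "{ij\<in>I \<times> I. fst ij \<noteq> snd ij}"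
  have J: "finite ?J" using I by (intro finite_subset[of ?J "I \<times> I"]) auto
  have "k_edges C m (\<omega> ` I) \<subseteq> map_prod \<omega> \<omega> ` {ij\<in>?J. \<omega> \<in> edge_event I m ij}"
  proof
    fix e assume e: "e \<in> k_edges C m (\<omega> ` I)"
    then obtain i j where ij: "i \<in> I" "j \<in> I" "e = (\<omega> i, \<omega> j)" "(\<omega> i, \<omega> j) \<in> chord_pairs C"
        "card (\<omega> ` I \<inter> edge_range C (\<omega> i) (\<omega> j)) = m"
      unfolding k_edges_def by auto
    have "i \<noteq> j" using ij(4) by (auto simp: chord_pairs_def)
    have "\<omega> ` I \<inter> edge_range C (\<omega> i) (\<omega> j) = \<omega> ` {l\<in>I - {i, j}. \<omega> l \<in> edge_range C (\<omega> i) (\<omega> j)}"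
      using k_edge_frontier[OF ij(4)] by auto
    moreover have "inj_on \<omega> {l\<in>I - {i, j}. \<omega> l \<in> edge_range C (\<omega> i) (\<omega> j)}"
      using inj by (rule inj_on_subset) auto
    ultimately have "card {l\<in>I - {i, j}. \<omega> l \<in> edge_range C (\<omega> i) (\<omega> j)} = m"
      using ij(5) by (simp only: card_image)
    then have "(i, j) \<in> {ij\<in>?J. \<omega> \<in> edge_event I m ij}"
      using ij \<open>i \<noteq> j\<close> sp by (simp add: edge_event_def)
    then show "e \<in> map_prod \<omega> \<omega> ` {ij\<in>?J. \<omega> \<in> edge_event I m ij}" using ij(3) by force
  qed
  moreover have "finite {ij\<in>?J. \<omega> \<in> edge_event I m ij}" using J by (rule rev_finite_subset) auto
  ultimately have "card (k_edges C m (\<omega> ` I)) \<le> card {ij\<in>?J. \<omega> \<in> edge_event I m ij}"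
    by (intro surj_card_le)
  also have "real (card {ij\<in>?J. \<omega> \<in> edge_event I m ij}) = (\<Sum>ij\<in>?J. indicator (edge_event I m ij) \<omega>)"
  proof -
    have "(\<Sum>ij\<in>?J. indicator (edge_event I m ij) \<omega> :: real) = (\<Sum>ij\<in>?J. if \<omega> \<in> edge_event I m ij then 1 else 0)"
      by (simp only: indicator_def of_bool_def)
    also have "\<dots> = (\<Sum>ij\<in>{ij\<in>?J. \<omega> \<in> edge_event I m ij}. 1)"
      using J by (simp only: sum.inter_filter)
    finally show ?thesis by simp
  qed
  finally show ?thesis by simp
qed

lemma expected_k_edges:
  assumes I: "finite I"
    and b: "\<And>p. 0 \<le> p \<Longrightarrow> p \<le> 1 \<Longrightarrow> binomial_weight (card I - 2) p m \<le> b"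
  shows "integrable (sample I) (\<lambda>\<omega>. real (card (k_edges C m (\<omega> ` I))))" (is "integrable _ ?E")
    and "(\<integral>\<omega>. real (card (k_edges C m (\<omega> ` I))) \<partial>sample I) \<le> real (card I) ^ 2 * b"
proof -
  interpret S: prob_space "sample I" by (rule prob_space_PiM_iid)
  let ?J = "{ij\<in>I \<times> I. fst ij \<noteq> snd ij}"
  let ?G = "\<lambda>\<omega>. \<Sum>ij\<in>?J. indicator (edge_event I m ij) \<omega> :: real"
  have J: "finite ?J" using I by (intro finite_subset[of ?J "I \<times> I"]) auto
  have ev: "edge_event I m ij \<in> sets (sample I)" if "ij \<in> ?J" for ij
    using that sets_edge_event[of "fst ij" I "snd ij" m] by auto
  have G: "integrable (sample I) ?G"
    using ev by (intro Bochner_Integration.integrable_sum integrable_real_indicator)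
       (auto simp: S.emeasure_eq_measure)
  have le: "AE \<omega> in sample I. ?E \<omega> \<le> ?G \<omega>"
    using AE_distinct[OF I] AE_space by eventually_elim (rule card_k_edges_le_events[OF I])
  show int: "integrable (sample I) ?E"
  proof (rule Bochner_Integration.integrable_bound[OF G borel_measurable_card_k_edges[OF I]])
    show "AE \<omega> in sample I. norm (?E \<omega>) \<le> norm (?G \<omega>)" using le by eventually_elim simp
  qed
  have b0: "0 \<le> b" using b[of 0] binomial_weight_nonneg[of 0 "card I - 2" m] by simp
  have "integral\<^sup>L (sample I) ?E \<le> integral\<^sup>L (sample I) ?G"
    by (rule integral_mono_AE[OF int G le])
  also have "\<dots> = (\<Sum>ij\<in>?J. measure (sample I) (edge_event I m ij))"
    using ev by (subst Bochner_Integration.integral_sum) (auto simp: S.emeasure_eq_measure)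
  also have "\<dots> \<le> (\<Sum>ij\<in>?J. b)"
  proof (rule sum_mono)
    fix ij assume ij: "ij \<in> ?J"
    have "emeasure (sample I) (edge_event I m (fst ij, snd ij)) \<le> ennreal b"
      using ij by (intro emeasure_edge_event[OF I] b) auto
    then show "measure (sample I) (edge_event I m ij) \<le> b"
      using b0 by (simp add: S.emeasure_eq_measure)
  qed
  also have "\<dots> = real (card ?J) * b" by simp
  also have "\<dots> \<le> real (card (I \<times> I)) * b"
  proof -
    have "card ?J \<le> card (I \<times> I)" using I by (intro card_mono) auto
    then show ?thesis using b0 by (intro mult_right_mono) (simp_all only: of_nat_le_iff)
  qed
  finally show "integral\<^sup>L (sample I) ?E \<le> real (card I) ^ 2 * b"
    by (simp add: card_cartesian_product power2_eq_square)
qed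

text \<open>
  For \<open>k = 0\<close> only the empty set occurs, which the summand \<open>card I\<close> covers. In the remaining cases
  \<open>card_k_sets_le\<close> applies almost surely, and \<open>{k-2..k}\<close> has at most three elements.
\<close>

lemma expected_k_sets:
  assumes I: "finite I" "I \<noteq> {}"
    and b: "\<And>p m. 0 \<le> p \<Longrightarrow> p \<le> 1 \<Longrightarrow> m \<in> {k-2..k} \<Longrightarrow> binomial_weight (card I - 2) p m \<le> b"
  shows "integrable (sample I) (\<lambda>\<omega>. real (card (k_sets C k (\<omega> ` I))))" (is "integrable _ ?A")
    and "(\<integral>\<omega>. real (card (k_sets C k (\<omega> ` I))) \<partial>sample I) \<le> real (card I) + 12 * (real (card I) ^ 2 * b)"
proof -
  interpret S: prob_space "sample I" by (rule prob_space_PiM_iid)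
  let ?E = "\<lambda>m \<omega>. real (card (k_edges C m (\<omega> ` I)))"
  let ?G = "\<lambda>\<omega>. real (card I) + (\<Sum>m\<in>{k-2..k}. 4 * ?E m \<omega>)"
  have E: "integrable (sample I) (?E m)" "integral\<^sup>L (sample I) (?E m) \<le> real (card I) ^ 2 * b"
    if "m \<in> {k-2..k}" for m
    using expected_k_edges[OF I(1) b[OF _ _ that]] by auto
  have G: "integrable (sample I) ?G"
    using E(1) by (intro Bochner_Integration.integrable_add Bochner_Integration.integrable_sum
      integrable_mult_right) auto
  have le: "AE \<omega> in sample I. ?A \<omega> \<le> ?G \<omega>"
    using AE_general_position[OF I(1)]
  proof eventually_elim
    fix \<omega> assume gp: "general_position (\<omega> ` I)"
    have "card (k_sets C k (\<omega> ` I)) \<le> card I + (\<Sum>m\<in>{k-2..k}. 4 * card (k_edges C m (\<omega> ` I)))"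
    proof (cases "k = 0")
      case True
      have "k_sets C 0 (\<omega> ` I) \<subseteq> {{}}"
        using I k_sets_iff[of "\<omega> ` I" _ 0] finite_subset[of _ "\<omega> ` I"] by auto
      then have "card (k_sets C 0 (\<omega> ` I)) \<le> card {{} :: (real^2) set}" by (intro card_mono) auto
      moreover have "1 \<le> card I" using I by (simp add: Suc_le_eq card_gt_0_iff)
      ultimately show ?thesis unfolding True by simp
    next
      case False
      then have "card (k_sets C k (\<omega> ` I)) \<le> card (\<omega> ` I) + (\<Sum>m\<in>{k-2..k}. 4 * card (k_edges C m (\<omega> ` I)))"
        using I gp by (intro card_k_sets_le) auto
      then show ?thesis using card_image_le[OF I(1), of \<omega>] by linarith
    qed
    then have "real (card (k_sets C k (\<omega> ` I)))
        \<le> real (card I + (\<Sum>m\<in>{k-2..k}. 4 * card (k_edges C m (\<omega> ` I))))"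
      by (simp only: of_nat_le_iff)
    then show "?A \<omega> \<le> ?G \<omega>" by simp
  qed
  show int: "integrable (sample I) ?A"
  proof (rule Bochner_Integration.integrable_bound[OF G borel_measurable_card_k_sets[OF I(1)]])
    show "AE \<omega> in sample I. norm (?A \<omega>) \<le> norm (?G \<omega>)" using le by eventually_elim simp
  qed
  have b0: "0 \<le> b" using b[of 0 k] binomial_weight_nonneg[of 0 "card I - 2" k] by simp
  have "integral\<^sup>L (sample I) ?A \<le> integral\<^sup>L (sample I) ?G"
    by (rule integral_mono_AE[OF int G le])
  also have "\<dots> = real (card I) + (\<Sum>m\<in>{k-2..k}. 4 * integral\<^sup>L (sample I) (?E m))"
    using E(1) by (subst Bochner_Integration.integral_add)
      (auto simp: Bochner_Integration.integral_sum S.prob_space intro!: Bochner_Integration.integrable_sum)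
  also have "(\<Sum>m\<in>{k-2..k}. 4 * integral\<^sup>L (sample I) (?E m)) \<le> (\<Sum>m\<in>{k-2..k}. 4 * (real (card I) ^ 2 * b))"
    using E(2) by (intro sum_mono mult_left_mono) auto
  also have "\<dots> = real (card {k-2..k}) * (4 * (real (card I) ^ 2 * b))" by simp
  also have "\<dots> \<le> 3 * (4 * (real (card I) ^ 2 * b))"
    using b0 by (intro mult_right_mono) auto
  finally show "integral\<^sup>L (sample I) ?A \<le> real (card I) + 12 * (real (card I) ^ 2 * b)" by simp
qed

end

theorem theorem4p10:
  fixes c :: real
  assumes "0 < c" and "c < 1"
  shows "\<exists>B::real. \<forall>(C::(real^2) set) (P::(real^2) measure) (n::nat).
    interior_strictly_convex_body C \<longrightarrow>
    prob_space P \<longrightarrow> sets P = sets borel \<longrightarrow>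
    (\<forall>x. measure P (frontier ((+) x ` C)) = 0) \<longrightarrow>
    n \<ge> 1 \<longrightarrow>
    (let M = PiM {..<n} (\<lambda>_. P);
         k = nat \<lfloor>c * real n\<rfloor>;
         E = (\<lambda>\<omega>. real (card (k_edges C k (\<omega> ` {..<n}))));
         A = (\<lambda>\<omega>. real (card (k_sets C k (\<omega> ` {..<n}))))
     in integrable M E \<and> integral\<^sup>L M E \<le> B * real n powr (3/2) \<and>
        integrable M A \<and> integral\<^sup>L M A \<le> B * real n powr (3/2))"
proof -
  define d where "d = min c (1 - c)"
  \<comment> \<open>The bound for edges has the constant \<open>4 / sqrt d\<close>; sets need at most twelve times this, and
      the linear term contributes \<open>1\<close>.\<close>
  define B where "B = 1 + 48 / sqrt d"
  have d: "0 < d" "d \<le> c" "d \<le> 1 - c" using assms by (auto simp: d_def)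
  show ?thesis
  proof (intro exI[of _ B] allI impI)
    fix C :: "(real^2) set" and P :: "(real^2) measure" and n :: nat
    assume C: "interior_strictly_convex_body C" and P: "prob_space P" "sets P = sets borel"
      and null: "\<forall>x. measure P (frontier ((+) x ` C)) = 0" and n: "1 \<le> n"
    interpret P: prob_space P by (rule P)
    interpret iid_sample C P using C P null by unfold_locales auto
    define k where "k = nat \<lfloor>c * real n\<rfloor>"
    define b where "b = 4 / sqrt (d * real n)"
    have b: "binomial_weight (card {..<n} - 2) p m \<le> b"
      if "0 \<le> p" "p \<le> 1" "m \<in> {k-2..k}" for p m
      using binomial_weight_linear_bound[OF d n] that by (simp add: b_def k_def)
    have pow: "real n ^ 2 / sqrt (real n) = real n powr (3/2)"
    proof -
      have "real n powr (3/2) = real n powr (2 - 1/2)" by simp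
      also have "\<dots> = real n powr 2 / real n powr (1/2)" by (rule powr_diff)
      finally show ?thesis using n by (simp add: powr_half_sqrt)
    qed
    have "real n ^ 2 * b = (4 / sqrt d) * (real n ^ 2 / sqrt (real n))"
      by (simp add: b_def real_sqrt_mult)
    then have nb: "real n ^ 2 * b = (4 / sqrt d) * real n powr (3/2)" by (simp only: pow)
    have npow: "real n \<le> real n powr (3/2)" using n powr_mono[of 1 "3/2" "real n"] by simp
    have "(4 / sqrt d) * real n powr (3/2) \<le> B * real n powr (3/2)"
      using d by (intro mult_right_mono) (auto simp: B_def field_simps)
    moreover have "real n + 12 * ((4 / sqrt d) * real n powr (3/2)) \<le> B * real n powr (3/2)"
      using npow by (simp add: B_def algebra_simps)
    moreover note expected_k_edges[of "{..<n}" k b] expected_k_sets[of "{..<n}" k b]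
    moreover have "{..<n} \<noteq> {}" using n by (auto simp: lessThan_empty_iff)
    ultimately show "let M = PiM {..<n} (\<lambda>_. P);
         k = nat \<lfloor>c * real n\<rfloor>;
         E = (\<lambda>\<omega>. real (card (k_edges C k (\<omega> ` {..<n}))));
         A = (\<lambda>\<omega>. real (card (k_sets C k (\<omega> ` {..<n}))))
     in integrable M E \<and> integral\<^sup>L M E \<le> B * real n powr (3/2) \<and>
        integrable M A \<and> integral\<^sup>L M A \<le> B * real n powr (3/2)"
      using b unfolding Let_def k_def[symmetric] by (force simp: nb)
  qed
qed

end
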